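(* Let $\mathcal{G}(\mathcal{V},\mathcal{E})$ be a connected, unweighted, undirected graph of order $n$ with Laplacian $\mathcal{L}$ and incidence matrix $\mathcal{B}\in\{-1,0,1\}^{n\times \ell}$ (with the convention in the context), let $t_0\ge 0$, and for $i\in\{1,\dots,n\}$ let $z_i(t)\in\mathbb{R}$ and $\mathbf{h}_i(t)\in\mathbb{R}^2$ be the bearing-derived signals described in the context. Let $\mathbf{H}(t)\in\mathbb{R}^{n\times2}$ be the matrix with $i$-th row $\mathbf{h}_i^\top(t)$ and $\mathbf{z}(t)=[z_1(t)\ \cdots\ z_n(t)]^\top$. Assume: 1. $\operatorname{rank}(\mathbf{H}(t))=2<n$ for all $t\ge0$; 2. the signals $z_i$ and $\mathbf{h}_i$ are bounded and continuously differentiable with bounded derivatives, and $\gamma>0$ is a constant such that $\sup_{t\in[t_0,\infty)}\|\dot{\boldsymbol{\phi}}_i(t)\|_\infty\le\gamma<\infty$ for all $i$, where $$\boldsymbol{\phi}_i(t)=\begin{bmatrix}\operatorname{vec}\left(\mathbf{h}_i(t)\mathbf{h}_i^\top(t)\right)\\ z_i(t)\mathbf{h}_i(t)\end{bmatrix}\in\mathbb{R}^6 .$$ Let $\boldsymbol{\phi}(t)=[\boldsymbol{\phi}_1^\top(t)\ \cdots\ \boldsymbol{\phi}_n^\top(t)]^\top$ and $\bar{\boldsymbol{\phi}}(t)=\frac1n\sum_{i=1}^n\boldsymbol{\phi}_i(t)$. Let $\mathbf{w}(t)$ and $\mathbf{x}(t)=[\boldsymbol{x}_1^\top(t)\ \cdots\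 \boldsymbol{x}_n^\top(t)]^\top\in\mathbb{R}^{6n}$, with $\boldsymbol{x}_i(t)\in\mathbb{R}^6$, be generated by $$\dot{\mathbf{w}}(t)=-\beta\,(\mathcal{B}\otimes I_6)\,\mathrm{sgn}\left\{(\mathcal{B}^\top\otimes I_6)\,\mathbf{x}(t)\right\},\qquad \mathbf{x}(t)=\mathbf{w}(t)+\boldsymbol{\phi}(t),\qquad t\ge t_0,\qquad \mathbf{w}(t_0)=\mathbf{0},$$ where $\beta\ge 1+\gamma\sqrt{\hat n}/\hat\lambda_2$ for positive constants $\hat n\ge n$ and $\hat\lambda_2\le\lambda_2(\mathcal{L})$. Let $\mathbf{P}_{\boldsymbol{x}_i}(t)$ be the $2\times2$ matrix whose $\operatorname{vec}$ is the first four entries of $\boldsymbol{x}_i(t)$, let $\mathbf{q}_{\boldsymbol{x}_i}(t)\in\mathbb{R}^2$ be the last two entries of $\boldsymbol{x}_i(t)$, and let sensor $i$ compute $$\boldsymbol{p}_i(t)=\left(\mathbf{P}_{\boldsymbol{x}_i}(t)\right)^{-1}\mathbf{q}_{\boldsymbol{x}_i}(t).$$ Then the individual solutions converge in finite time to the optimal solution $$\boldsymbol{p}^*(t)=\left(\mathbf{H}^\top(t)\mathbf{H}(t)\right)^{-1}\mathbf{H}^\top(t)\mathbf{z}(t)$$ of $\min_{\boldsymbol{y}\in\mathbb{R}^2}\frac12\|\mathbf{z}(t)-\mathbf{H}(t)\boldsymbol{y}\|_2^2$; that is, for all $t\ge t^*$, $$\boldsymbol{p}_i(t)=\boldsymbol{p}^*(t)\quad\text{for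 all } i\in\{1,\dots,n\},$$ where $t^*=t_0+\dfrac{\|\tilde{\mathbf{x}}(t_0)\|_2}{\lambda_2(\mathcal{L})}$ and $\tilde{\mathbf{x}}(t)=\mathbf{x}(t)-\mathbf{1}_n\otimes\bar{\boldsymbol{\phi}}(t)$.
   Context: Graph conventions. $\mathcal{V}=\{v_1,\dots,v_n\}$. Each undirected edge is regarded as two distinct directed edges (one in each direction), and $\mathcal{E}=\{e_1,\dots,e_\ell\}$ lists all these directed edges. The adjacency matrix is $\mathcal{A}=[a_{ij}]\in\{0,1\}^{n\times n}$ with $a_{ij}=1$ if $(v_i,v_j)\in\mathcal{E}$ and $a_{ij}=0$ otherwise; the graph is simple (no self-loops). The Laplacian is $\mathcal{L}=\mathrm{diag}(\mathcal{A}\mathbf{1}_n)-\mathcal{A}$. The incidence matrix $\mathcal{B}=[b_{ij}]\in\{-1,0,1\}^{n\times\ell}$ has $b_{ij}=-1$ if $e_j$ leaves $v_i$, $b_{ij}=1$ if $e_j$ enters $v_i$, and $b_{ij}=0$ otherwise. $\lambda_2(\mathcal{L})$ is the second-smallest eigenvalue of $\mathcal{L}$ (the algebraic connectivity). Notation. $\mathbf{1}_n$ is the all-ones vector in $\mathbb{R}^n$, $I_6$ the $6\times 6$ identity, $\otimes$ the Kronecker product, $\mathrm{sgn}\{\cdot\}$ the signum function applied componentwise, $\operatorname{vec}$ stacks the columns of a matrix into a vector, and $\|\cdot\|_p$ is the vector $p$-norm. Signals. There are $n$ stationary sensors at positions $\boldsymbol{s}_i\in\mathbb{R}^2$, and a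 target with position $\boldsymbol{p}(t)\in\mathbb{R}^2$, $\dot{\boldsymbol{p}}(t)=\mathbf{v}(t)$, with $\boldsymbol{p}(t)\neq \boldsymbol{s}_i$ so that bearings are defined. Sensor $i$ measures the bearing angle $\theta_i(t)\in[0,2\pi)$ defined by $[\cos\theta_i(t)\ \ \sin\theta_i(t)]^\top=(\boldsymbol{p}(t)-\boldsymbol{s}_i)/\|\boldsymbol{p}(t)-\boldsymbol{s}_i\|_2$. Then $\mathbf{h}_i(t)=[-\sin\theta_i(t)\ \ \cos\theta_i(t)]^\top$ and $z_i(t)=\mathbf{h}_i^\top(t)\boldsymbol{s}_i$. Solutions. Because the right-hand side is discontinuous, solutions on $[t_0,\infty)$ are understood in the Filippov sense (locally absolutely continuous functions satisfying the associated Filippov differential inclusion for almost every $t$); the assertion concerns every such solution. *)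

theory Defs
  imports
    "HOL-Analysis.Analysis"
    "Graph_Theory.Digraph_Component"
begin

text \<open>
  An undirected simple graph is a symmetric, loop-free digraph without parallel arcs (locale
  \<open>graph\<close>), so every undirected edge contributes two arcs. In the matrices below the vertices
  are all elements of the type \<open>'n\<close> and the arcs all elements of the type \<open>'e\<close>.
\<close>

definition adjacency :: "('n::finite, 'e) pre_digraph \<Rightarrow> real^'n^'n" where
  "adjacency G = (\<chi> i j. if (i, j) \<in> arcs_ends G then 1 else 0)"

definition diag_mat :: "real^'n \<Rightarrow> real^'n^'n" where
  "diag_mat v = (\<chi> i j. if i = j then v $ i else 0)"

definition laplacian :: "('n::finite, 'e) pre_digraph \<Rightarrow> real^'n^'n" where
  "laplacian G = diag_mat (adjacency G *v 1) - adjacency G"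

definition incidence :: "('n::finite, 'e::finite) pre_digraph \<Rightarrow> real^'e^'n" where
  "incidence G = (\<chi> i j. if tail G j = i then - 1 else if head G j = i then 1 else 0)"

definition charpoly :: "real^'n^'n \<Rightarrow> real poly" where
  "charpoly A = det (\<chi> i j. (if i = j then [:0, 1:] else 0) - [:A $ i $ j:])"

text \<open>The real eigenvalues in ascending order, repeated according to algebraic multiplicity;
  \<open>\<lambda>\<^sub>2\<close> is the entry with 0-based index 1.\<close>

definition eigenvalue_list :: "real^'n^'n \<Rightarrow> real list" where
  "eigenvalue_list A = sorted_list_of_multiset (proots (charpoly A))"

definition lambda2 :: "real^'n^'n \<Rightarrow> real" where
  "lambda2 A = eigenvalue_list A ! 1"

text \<open>A vector in \<open>\<real>\<^bsup>mn\<^esup>\<close> that consists of \<open>m\<close> consecutive blocks of length \<open>n\<close> is indexed by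
  pairs (block, position within the block).\<close>

definition kron_mat :: "real^'c^'r \<Rightarrow> real^'d^'s \<Rightarrow> real^('c \<times> 'd)^('r \<times> 's)" where
  "kron_mat A B = (\<chi> k l. A $ fst k $ fst l * B $ snd k $ snd l)"

definition kron_vec :: "real^'r \<Rightarrow> real^'s \<Rightarrow> real^('r \<times> 's)" where
  "kron_vec u v = (\<chi> k. u $ fst k * v $ snd k)"

definition stack :: "('r::finite \<Rightarrow> real^'s) \<Rightarrow> real^('r \<times> 's)" where
  "stack f = (\<chi> k. f (fst k) $ snd k)"

definition block :: "real^('r::finite \<times> 's::finite) \<Rightarrow> 'r \<Rightarrow> real^'s" where
  "block x i = (\<chi> a. x $ (i, a))"

definition sgn_vec :: "real^'k \<Rightarrow> real^'k" where
  "sgn_vec v = (\<chi> k. sgn (v $ k))"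

definition outer :: "real^'m \<Rightarrow> real^'n \<Rightarrow> real^'n^'m" where
  "outer u v = (\<chi> i j. u $ i * v $ j)"

text \<open>Column-stacking of a \<open>2 \<times> 2\<close> matrix; the first index of \<open>M $ i $ j\<close> is the row.\<close>

definition vec_mat :: "real^2^2 \<Rightarrow> real^4" where
  "vec_mat M = vector [M $ 1 $ 1, M $ 2 $ 1, M $ 1 $ 2, M $ 2 $ 2]"

definition append_vec :: "real^4 \<Rightarrow> real^2 \<Rightarrow> real^6" where
  "append_vec u v = vector [u $ 1, u $ 2, u $ 3, u $ 4, v $ 1, v $ 2]"

definition regressor :: "real^2 \<Rightarrow> real \<Rightarrow> real^6" where
  "regressor h z = append_vec (vec_mat (outer h h)) (z *\<^sub>R h)"

text \<open>The outermost list in \<open>P_part\<close> is the list of rows.\<close>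

definition P_part :: "real^6 \<Rightarrow> real^2^2" where
  "P_part x = vector [vector [x $ 1, x $ 3], vector [x $ 2, x $ 4]]"

definition q_part :: "real^6 \<Rightarrow> real^2" where
  "q_part x = vector [x $ 5, x $ 6]"

lemma vector_4:
  fixes a b c d :: real
  defines "v \<equiv> vector [a, b, c, d] :: real^4"
  shows "v $ 1 = a" "v $ 2 = b" "v $ 3 = c" "v $ 4 = d"
  unfolding v_def vector_def by simp_all

lemma vector_6:
  fixes a b c d e f :: real
  defines "v \<equiv> vector [a, b, c, d, e, f] :: real^6"
  shows "v $ 1 = a" "v $ 2 = b" "v $ 3 = c" "v $ 4 = d" "v $ 5 = e" "v $ 6 = f"
  unfolding v_def vector_def by simp_all

lemma vec_mat_nth:
  "vec_mat M $ 1 = M $ 1 $ 1" "vec_mat M $ 2 = M $ 2 $ 1"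
  "vec_mat M $ 3 = M $ 1 $ 2" "vec_mat M $ 4 = M $ 2 $ 2"
  by (simp_all add: vec_mat_def vector_4)

lemma vec_mat_P_part: "vec_mat (P_part x) = vector [x $ 1, x $ 2, x $ 3, x $ 4]"
  by (simp add: vec_mat_def P_part_def)

lemma P_part_append_vec: "P_part (append_vec (vec_mat M) q) = M"
  by (simp add: vec_eq_iff forall_2 P_part_def append_vec_def vector_6 vec_mat_nth)

lemma q_part_append_vec: "q_part (append_vec u q) = q"
  by (simp add: vec_eq_iff forall_2 q_part_def append_vec_def vector_6)

definition bounded_C1_on :: "real set \<Rightarrow> (real \<Rightarrow> 'a::real_normed_vector) \<Rightarrow> bool" where
  "bounded_C1_on S f \<longleftrightarrow> bounded (f ` S) \<and>
    (\<exists>f'. (\<forall>t\<in>S. (f has_vector_derivative f' t) (at t within S)) \<and>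
          continuous_on S f' \<and> bounded (f' ` S))"

text \<open>The elements of a division are nonempty compact intervals with pairwise disjoint interiors,
  so that \<open>Inf K\<close> and \<open>Sup K\<close> are the end points of \<open>K\<close>.\<close>

definition abs_continuous_on :: "real \<Rightarrow> real \<Rightarrow> (real \<Rightarrow> 'a::real_normed_vector) \<Rightarrow> bool" where
  "abs_continuous_on a b f \<longleftrightarrow>
    (\<forall>\<epsilon>>0. \<exists>\<delta>>0. \<forall>D. D division_of \<Union>D \<and> \<Union>D \<subseteq> {a..b} \<and> (\<Sum>K\<in>D. Sup K - Inf K) < \<delta> \<longrightarrow>
       (\<Sum>K\<in>D. norm (f (Sup K) - f (Inf K))) < \<epsilon>)"

definition filippov_map :: "('a::euclidean_space \<Rightarrow> 'a) \<Rightarrow> 'a \<Rightarrow> 'a set" where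
  "filippov_map f x =
    (\<Inter>\<delta>\<in>{0<..}. \<Inter>N\<in>null_sets lebesgue. closure (convex hull (f ` (ball x \<delta> - N))))"

definition filippov_solution ::
    "(real \<Rightarrow> 'a::euclidean_space \<Rightarrow> 'a) \<Rightarrow> real \<Rightarrow> (real \<Rightarrow> 'a) \<Rightarrow> bool" where
  "filippov_solution f t0 w \<longleftrightarrow>
    (\<forall>a b. t0 \<le> a \<and> a \<le> b \<longrightarrow> abs_continuous_on a b w) \<and>
    (AE t in lebesgue. t0 \<le> t \<longrightarrow>
       (\<exists>w'. (w has_vector_derivative w') (at t) \<and> w' \<in> filippov_map (f t) (w t)))"

text \<open>The state is \<open>w\<close>, and \<open>w + \<phi> t\<close> is the protocol's output \<open>x\<close>.\<close>

definition consensus_field ::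
    "('n::finite, 'e::finite) pre_digraph \<Rightarrow> real \<Rightarrow> (real \<Rightarrow> real^('n \<times> 6)) \<Rightarrow>
     real \<Rightarrow> real^('n \<times> 6) \<Rightarrow> real^('n \<times> 6)" where
  "consensus_field G \<beta> \<phi> t w =
    (- \<beta>) *\<^sub>R (kron_mat (incidence G) (mat 1 :: real^6^6) *v
      sgn_vec (kron_mat (transpose (incidence G)) (mat 1 :: real^6^6) *v (w + \<phi> t)))"

end

theory Submission
  imports Defs
begin

text \<open>
  Let \<open>e = x - 1 \<otimes> \<phi>bar\<close> be the disagreement. The columns of the incidence matrix \<open>B\<close> sum to zero,
  so the protocol conserves the sum of the agents' states, and \<open>e\<close> sums to zero over the agents
  for all times. The claim is that \<open>norm e\<close> decreases at rate at least \<open>\<lambda>\<^sub>2\<close> as long as it is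
  positive; it then reaches zero by time \<open>t_star\<close> and cannot leave it.

  The decrease rests on three estimates. First, the right-hand side is set-valued, but its inner
  product with \<open>e\<close> is not: a coordinate of \<open>(B\<^sup>T \<otimes> I) x\<close> whose sign is ambiguous is zero and drops
  out, so every element \<open>v\<close> of the Filippov set satisfies \<open>e \<bullet> v = - \<beta> S\<close>, where \<open>S\<close> is the 1-norm
  of \<open>(B\<^sup>T \<otimes> I) e\<close> (\<open>consensus_filippov_inner\<close>). Secondly, the signals push with at most
  \<open>e \<bullet> \<phi>' \<le> \<gamma> * (1-norm of e)\<close>. Thirdly, \<open>S\<close> dominates both terms through the Laplacian: entry \<open>i\<close> of
  \<open>L u\<close> is a sum of differences along the arcs that leave \<open>i\<close>, so for each component \<open>u\<close> of \<open>e\<close>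
  the sum of the absolute differences along the arcs is at least \<open>norm (L u) \<ge> \<lambda>\<^sub>2 * norm u\<close>. This
  gives \<open>S \<ge> \<lambda>\<^sub>2 * norm e\<close>, and with the Cauchy-Schwarz inequality \<open>e \<bullet> \<phi>' \<le> (\<gamma> * sqrt n / \<lambda>\<^sub>2) * S\<close>.
  The gain condition on \<open>\<beta>\<close> leaves \<open>e \<bullet> e' \<le> - S\<close>, hence \<open>(norm e)' \<le> - \<lambda>\<^sub>2\<close>. The inequality
  holds almost everywhere, and absolute continuity of the solution allows it to be integrated
  (\<open>abs_continuous_increment_le\<close>).

  The bound \<open>norm (L u) \<ge> \<lambda>\<^sub>2 * norm u\<close> for \<open>u\<close> orthogonal to the ones vector comes from
  minimising the quadratic form of \<open>L\<close>. The minimum over the unit sphere of that subspace is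
  attained at an eigenvector, with eigenvalue \<open>\<mu>\<close> say. Connectedness makes \<open>\<mu>\<close> positive, so
  \<open>0 < \<mu>\<close> are two distinct roots of the characteristic polynomial, and the second entry of the
  sorted list of roots is at most \<open>\<mu>\<close>.

  After \<open>t_star\<close> every agent holds the average of the \<open>\<phi>\<^sub>i\<close>, whose matrix and vector parts are
  \<open>H\<^sup>T H / n\<close> and \<open>H\<^sup>T z / n\<close>. The factors \<open>1 / n\<close> cancel, which leaves the normal equations of the
  least-squares problem.
\<close>


section \<open>Absolutely continuous functions\<close>

lemma abs_continuous_onE:
  assumes "abs_continuous_on a b f" and "\<epsilon> > 0"
  obtains \<delta> where "\<delta> > 0" and "\<forall>D. D division_of \<Union>D \<longrightarrow> \<Union>D \<subseteq> {a..b} \<longrightarrow>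
      (\<Sum>K\<in>D. Sup K - Inf K) < \<delta> \<longrightarrow> (\<Sum>K\<in>D. norm (f (Sup K) - f (Inf K))) < \<epsilon>"
proof -
  from assms(1)[unfolded abs_continuous_on_def, rule_format, OF assms(2)]
  obtain \<delta> where "\<delta> > 0" and \<delta>: "\<forall>D. D division_of \<Union>D \<and> \<Union>D \<subseteq> {a..b} \<and>
      (\<Sum>K\<in>D. Sup K - Inf K) < \<delta> \<longrightarrow> (\<Sum>K\<in>D. norm (f (Sup K) - f (Inf K))) < \<epsilon>"
    by (elim exE conjE)
  show thesis by (rule that[OF \<open>\<delta> > 0\<close>]) (use \<delta> in blast)
qed

text \<open>
  The solution \<open>w\<close> is absolutely continuous by definition; this transfers the property to
  everything built from \<open>w\<close> by a Lipschitz map and from a signal that is Lipschitz in time.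
\<close>

lemma abs_continuous_on_dominated:
  assumes f: "abs_continuous_on a b f"
    and dom: "\<And>s t. s \<in> {a..b} \<Longrightarrow> t \<in> {a..b} \<Longrightarrow> norm (g t - g s) \<le> B * norm (f t - f s) + C * \<bar>t - s\<bar>"
  shows "abs_continuous_on a b g"
  unfolding abs_continuous_on_def
proof (intro allI impI)
  fix \<epsilon> :: real assume "\<epsilon> > 0"
  then have "\<epsilon> / (2 * (\<bar>B\<bar> + 1)) > 0" by (simp add: add_nonneg_pos)
  from f this obtain \<delta> where "\<delta> > 0" and \<delta>_all: "\<forall>D. D division_of \<Union>D \<longrightarrow> \<Union>D \<subseteq> {a..b} \<longrightarrow>
      (\<Sum>K\<in>D. Sup K - Inf K) < \<delta> \<longrightarrow>
      (\<Sum>K\<in>D. norm (f (Sup K) - f (Inf K))) < \<epsilon> / (2 * (\<bar>B\<bar> + 1))"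
    by (rule abs_continuous_onE)
  note \<delta> = \<delta>_all[rule_format]
  define \<delta>' where "\<delta>' = min \<delta> (\<epsilon> / (2 * (\<bar>C\<bar> + 1)))"
  have "\<delta>' > 0" using \<open>\<delta> > 0\<close> \<open>\<epsilon> > 0\<close> by (simp add: \<delta>'_def add_nonneg_pos)
  moreover have "(\<Sum>K\<in>D. norm (g (Sup K) - g (Inf K))) < \<epsilon>"
    if D: "D division_of \<Union>D" "\<Union>D \<subseteq> {a..b}" "(\<Sum>K\<in>D. Sup K - Inf K) < \<delta>'" for D
  proof -
    have ends: "Inf K \<in> {a..b} \<and> Sup K \<in> {a..b} \<and> Inf K \<le> Sup K" if KD: "K \<in> D" for K
    proof -
      obtain u v where K: "K = {u..v}"
        using division_ofD(4)[OF D(1) KD] by (auto simp: cbox_interval)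
      have "K \<noteq> {}" using division_ofD(3)[OF D(1) that] .
      moreover have "K \<subseteq> {a..b}" using that D(2) by blast
      ultimately show ?thesis using K by auto
    qed
    have "(\<Sum>K\<in>D. norm (g (Sup K) - g (Inf K)))
        \<le> (\<Sum>K\<in>D. (\<bar>B\<bar> + 1) * norm (f (Sup K) - f (Inf K)) + \<bar>C\<bar> * (Sup K - Inf K))"
    proof (rule sum_mono)
      fix K assume "K \<in> D"
      note K = ends[OF this]
      have "norm (g (Sup K) - g (Inf K)) \<le> B * norm (f (Sup K) - f (Inf K)) + C * \<bar>Sup K - Inf K\<bar>"
        using K by (intro dom) auto
      also have "\<dots> \<le> (\<bar>B\<bar> + 1) * norm (f (Sup K) - f (Inf K)) + \<bar>C\<bar> * (Sup K - Inf K)"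
        using K by (intro add_mono mult_mono) auto
      finally show "norm (g (Sup K) - g (Inf K))
          \<le> (\<bar>B\<bar> + 1) * norm (f (Sup K) - f (Inf K)) + \<bar>C\<bar> * (Sup K - Inf K)" .
    qed
    also have "\<dots> = (\<bar>B\<bar> + 1) * (\<Sum>K\<in>D. norm (f (Sup K) - f (Inf K)))
        + \<bar>C\<bar> * (\<Sum>K\<in>D. Sup K - Inf K)"
      by (simp add: sum.distrib sum_distrib_left)
    also have "\<dots> < \<epsilon>/2 + \<epsilon>/2"
    proof (rule add_less_le_mono)
      have "(\<Sum>K\<in>D. norm (f (Sup K) - f (Inf K))) < \<epsilon> / (2 * (\<bar>B\<bar> + 1))"
        using D by (intro \<delta>) (auto simp: \<delta>'_def)
      then show "(\<bar>B\<bar> + 1) * (\<Sum>K\<in>D. norm (f (Sup K) - f (Inf K))) < \<epsilon>/2"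
        by (simp add: field_simps add_nonneg_pos)
      have "\<bar>C\<bar> * (\<Sum>K\<in>D. Sup K - Inf K) \<le> (\<bar>C\<bar> + 1) * (\<epsilon> / (2 * (\<bar>C\<bar> + 1)))"
        using D ends by (intro mult_mono) (auto simp: \<delta>'_def intro!: sum_nonneg)
      also have "\<dots> = \<epsilon>/2" by (simp add: field_simps)
      finally show "\<bar>C\<bar> * (\<Sum>K\<in>D. Sup K - Inf K) \<le> \<epsilon>/2" .
    qed
    finally show ?thesis by simp
  qed
  ultimately show "\<exists>\<delta>>0. \<forall>D. D division_of \<Union>D \<and> \<Union>D \<subseteq> {a..b} \<and> (\<Sum>K\<in>D. Sup K - Inf K) < \<delta> \<longrightarrow>
       (\<Sum>K\<in>D. norm (g (Sup K) - g (Inf K))) < \<epsilon>" by blast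
qed

text \<open>
  A tagged division that is fine for a suitable gauge separates the two kinds of points. At a tag
  where the derivative exists, it controls the increment over the interval of the tag. The other
  tags lie in a null set, the gauge confines their intervals to an open set of small measure, and
  absolute continuity makes the sum of the increments over those intervals small.
\<close>

lemma abs_continuous_increment_le:
  fixes g :: "real \<Rightarrow> real"
  assumes "a \<le> b" and ac: "abs_continuous_on a b g"
    and ae: "AE t in lebesgue. a < t \<and> t < b \<longrightarrow> (\<exists>d\<le>c. (g has_real_derivative d) (at t))"
  shows "g b - g a \<le> c * (b - a)"
proof -
  have main: "g b - g a \<le> c * (b - a) + \<epsilon> * (b - a + 2)" if "\<epsilon> > 0" for \<epsilon>
  proof -
    from ac \<open>\<epsilon> > 0\<close> obtain \<delta> where "\<delta> > 0"
      and \<delta>_all: "\<forall>D. D division_of \<Union>D \<longrightarrow> \<Union>D \<subseteq> {a..b} \<longrightarrow>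
        (\<Sum>K\<in>D. Sup K - Inf K) < \<delta> \<longrightarrow> (\<Sum>K\<in>D. norm (g (Sup K) - g (Inf K))) < \<epsilon>"
      by (rule abs_continuous_onE)
  note \<delta> = \<delta>_all[rule_format]
    define \<eta> where "\<eta> = min \<delta> (\<epsilon> / (\<bar>c\<bar> + 1))"
    have "\<eta> > 0" using \<open>\<delta> > 0\<close> \<open>\<epsilon> > 0\<close> by (simp add: \<eta>_def add_nonneg_pos)
    obtain N0 where N0: "N0 \<in> null_sets lebesgue" and bad:
      "{t \<in> space lebesgue. \<not> (a < t \<and> t < b \<longrightarrow> (\<exists>d\<le>c. (g has_real_derivative d) (at t)))} \<subseteq> N0"
      using ae unfolding eventually_ae_filter by blast
    \<comment> \<open>The end points join the exceptional set because the hypothesis covers only the open interval.\<close>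
    define N where "N = N0 \<union> {a, b}"
    have "{a, b} \<in> null_sets lebesgue"
      by (simp add: negligible_iff_null_sets[symmetric])
    then have N: "N \<in> null_sets lebesgue" unfolding N_def using N0 by blast
    obtain U where U: "open U" "N \<subseteq> U" "U - N \<in> lmeasurable" "emeasure lebesgue (U - N) < ennreal \<eta>"
      using sets_lebesgue_outer_open[of N \<eta>] N \<open>\<eta> > 0\<close> by auto
    have "U - N \<union> N = U" using U by auto
    then have U_meas: "U \<in> lmeasurable" "emeasure lebesgue U = emeasure lebesgue (U - N)"
      using emeasure_Un_null_set[of "U - N" lebesgue N] U N
      by (auto simp: fmeasurable_def)
    have mU: "measure lebesgue U < \<eta>"
    proof -
      have "ennreal (measure lebesgue U) < ennreal \<eta>"
        using U(4) emeasure_eq_measure2[OF U_meas(1)] U_meas(2) by simp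
      then show ?thesis by (simp add: ennreal_less_iff)
    qed
    \<comment> \<open>The factor \<open>sgn (y - t)\<close> states the bounds to the left and to the right of the tag at once.\<close>
    have "\<exists>r>0. \<forall>y. \<bar>y - t\<bar> < r \<longrightarrow> (g y - g t) * sgn (y - t) \<le> (c + \<epsilon>) * \<bar>y - t\<bar>"
      if "t \<in> {a..b} - N" for t
    proof -
      have "t \<notin> N0" "a < t" "t < b" using that by (auto simp: N_def)
      then obtain d where "d \<le> c" and d: "(g has_real_derivative d) (at t)" using bad by auto
      then obtain r where "r > 0" and r: "\<And>y. norm (y - t) < r \<Longrightarrow>
          norm (g y - g t - d * (y - t)) \<le> \<epsilon> * norm (y - t)"
        using \<open>\<epsilon> > 0\<close> unfolding has_field_derivative_def has_derivative_at_alt by metis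
      have "(g y - g t) * sgn (y - t) \<le> (c + \<epsilon>) * \<bar>y - t\<bar>" if "\<bar>y - t\<bar> < r" for y
      proof -
        have "\<bar>(g y - g t - d * (y - t)) * sgn (y - t)\<bar> \<le> \<epsilon> * \<bar>y - t\<bar>"
          using r[of y] that by (auto simp: abs_mult sgn_if)
        moreover have "(g y - g t) * sgn (y - t)
            = (g y - g t - d * (y - t)) * sgn (y - t) + d * \<bar>y - t\<bar>"
          by (simp add: algebra_simps abs_sgn sgn_if)
        moreover have "d * \<bar>y - t\<bar> \<le> c * \<bar>y - t\<bar>" using \<open>d \<le> c\<close> by (simp add: mult_right_mono)
        ultimately show ?thesis unfolding distrib_right by linarith
      qed
      then show ?thesis using \<open>r > 0\<close> by blast
    qed
    then obtain r where r: "\<And>t. t \<in> {a..b} - N \<Longrightarrow> r t > 0"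
      "\<And>t y. t \<in> {a..b} - N \<Longrightarrow> \<bar>y - t\<bar> < r t \<Longrightarrow> (g y - g t) * sgn (y - t) \<le> (c + \<epsilon>) * \<bar>y - t\<bar>"
      by metis
    define G where "G t = (if t \<in> N then U else if t \<in> {a..b} then ball t (r t) else UNIV)" for t
    have "gauge G" using U r by (auto simp: gauge_def G_def)
    then obtain P where P: "P tagged_division_of {a..b}" "G fine P"
      using fine_division_exists_real by blast
    note td = tagged_division_ofD[OF P(1)]
    define Q where "Q = {(t, K) \<in> P. t \<in> N}"
    have "Q tagged_partial_division_of {a..b}"
      using P(1) tagged_partial_division_subset[of P "{a..b}" Q]
      by (auto simp: tagged_division_of_def Q_def)
    then have Q: "Q tagged_division_of \<Union>(snd ` Q)" and DQ: "snd ` Q division_of \<Union>(snd ` Q)"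
      by (auto intro: tagged_partial_division_of_Union_self partial_division_of_tagged_division)
    have QP: "Q \<subseteq> P" by (auto simp: Q_def)
    have nonempty: "K \<noteq> {}" if "(t, K) \<in> Q" for t K
      using td(2)[of t K] that by (auto simp: Q_def)
    \<comment> \<open>Distinct tags can share only a degenerate interval, so terms that vanish there may be summed over intervals.\<close>
    have reindex: "(\<Sum>(t, K)\<in>Q. k K) = (\<Sum>K\<in>snd ` Q. k K)"
      if "\<And>u. k {u} = 0" for k :: "real set \<Rightarrow> real"
    proof -
      define k' where "k' K = (if K = {} then 0 else k K)" for K
      have "(\<Sum>(t, K)\<in>Q. k K) = (\<Sum>(t, K)\<in>Q. k' K)"
        by (intro sum.cong) (auto simp: k'_def dest: nonempty)
      also have "\<dots> = (\<Sum>K\<in>snd ` Q. k' K)"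
      proof (rule sum.over_tagged_division_lemma[OF Q])
        fix u v :: real assume "box u v = {}"
        then have "cbox u v = {} \<or> cbox u v = {u}" by (cases "u = v") auto
        then show "k' (cbox u v) = 0" using that by (auto simp: k'_def)
      qed
      also have "\<dots> = (\<Sum>K\<in>snd ` Q. k K)"
        by (intro sum.cong) (auto simp: k'_def dest: nonempty)
      finally show ?thesis .
    qed
    have interval: "\<exists>u v. K = {u..v} \<and> u \<le> t \<and> t \<le> v \<and> a \<le> u \<and> v \<le> b" if tK: "(t, K) \<in> P" for t K
    proof -
      obtain u v where K: "K = {u..v}" using td(4)[OF tK] by (auto simp: cbox_interval)
      have "t \<in> K" "K \<subseteq> {a..b}" using td(2,3)[OF tK] by auto
      then show ?thesis using K by auto
    qed
    have Q_interval: "\<exists>u v. K = {u..v} \<and> u \<le> v \<and> a \<le> u \<and> v \<le> b" if KQ: "K \<in> snd ` Q" for K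
    proof -
      obtain t where "(t, K) \<in> P" using KQ QP by auto
      from interval[OF this] show ?thesis using order_trans by blast
    qed
    have len: "(\<Sum>K\<in>snd ` Q. Sup K - Inf K) < \<eta>"
    proof -
      have "(\<Sum>K\<in>snd ` Q. Sup K - Inf K) = (\<Sum>K\<in>snd ` Q. measure lebesgue K)"
      proof (rule sum.cong[OF refl])
        fix K assume "K \<in> snd ` Q"
        then obtain u v where "K = {u..v}" "u \<le> v" using Q_interval by blast
        then show "Sup K - Inf K = measure lebesgue K" by simp
      qed
      also have "\<dots> = measure lebesgue (\<Union>(snd ` Q))"
        using content_division[OF DQ] .
      also have "\<dots> \<le> measure lebesgue U"
      proof (rule measure_mono_fmeasurable)
        show "\<Union>(snd ` Q) \<subseteq> U"
        proof (rule Union_least)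
          fix K assume "K \<in> snd ` Q"
          then obtain t where "(t, K) \<in> P" "t \<in> N" by (auto simp: Q_def)
          then show "K \<subseteq> U" using fineD[OF P(2), of t K] by (simp add: G_def)
        qed
        show "\<Union>(snd ` Q) \<in> sets lebesgue"
          using DQ by (meson fmeasurableD lmeasurable_division)
      qed (fact U_meas)
      finally show ?thesis using mU by simp
    qed
    have var: "(\<Sum>K\<in>snd ` Q. norm (g (Sup K) - g (Inf K))) < \<epsilon>"
    proof (rule \<delta>[OF DQ])
      show "\<Union>(snd ` Q) \<subseteq> {a..b}"
      proof (rule Union_least)
        fix K assume "K \<in> snd ` Q"
        then show "K \<subseteq> {a..b}" using Q_interval by force
      qed
    qed (use len in \<open>simp add: \<eta>_def\<close>)
    have tag: "g (Sup K) - g (Inf K) \<le> (c + \<epsilon>) * (Sup K - Inf K)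
        + (if t \<in> N then norm (g (Sup K) - g (Inf K)) + \<bar>c\<bar> * (Sup K - Inf K) else 0)"
      if tK: "(t, K) \<in> P" for t K
    proof -
      obtain u v where K: "K = {u..v}" "u \<le> t" "t \<le> v" "a \<le> u" "v \<le> b" using interval[OF tK] by blast
      show ?thesis
      proof (cases "t \<in> N")
        case True
        have "- \<bar>c\<bar> * (v - u) \<le> c * (v - u)" using K by (intro mult_right_mono) auto
        moreover have "0 \<le> \<epsilon> * (v - u)" using K \<open>\<epsilon> > 0\<close> by simp
        moreover have "(c + \<epsilon>) * (v - u) = c * (v - u) + \<epsilon> * (v - u)" by (rule distrib_right)
        moreover have "Sup K = v" "Inf K = u" using K by auto
        ultimately show ?thesis using True abs_ge_self[of "g v - g u"] by simp
      next
        case False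
        then have t: "t \<in> {a..b} - N" using K by auto
        have "K \<subseteq> ball t (r t)" using fineD[OF P(2) tK] t by (simp add: G_def split: if_splits)
        moreover have "u \<in> K" "v \<in> K" using K by auto
        ultimately have "u \<in> ball t (r t)" "v \<in> ball t (r t)" by blast+
        then have "\<bar>u - t\<bar> < r t" "\<bar>v - t\<bar> < r t" by (auto simp: dist_real_def)
        from this[THEN r(2)[OF t]] have "g v - g t \<le> (c + \<epsilon>) * (v - t)" "g t - g u \<le> (c + \<epsilon>) * (t - u)"
          using K by (auto simp: sgn_if split: if_splits)
        then have "g v - g u \<le> (c + \<epsilon>) * (v - t) + (c + \<epsilon>) * (t - u)" by linarith
        also have "\<dots> = (c + \<epsilon>) * (v - u)" by (simp add: algebra_simps)
        finally show ?thesis using K False by simp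
      qed
    qed
    have "g b - g a = (\<Sum>(t, K)\<in>P. g (Sup K) - g (Inf K))"
      using additive_tagged_division_1[OF \<open>a \<le> b\<close> P(1), of g] by simp
    also have "\<dots> \<le> (\<Sum>(t, K)\<in>P. (c + \<epsilon>) * (Sup K - Inf K)
        + (if t \<in> N then norm (g (Sup K) - g (Inf K)) + \<bar>c\<bar> * (Sup K - Inf K) else 0))"
      by (rule sum_mono) (use tag in auto)
    also have "\<dots> = (\<Sum>(t, K)\<in>P. (c + \<epsilon>) * (Sup K - Inf K))
        + (\<Sum>(t, K)\<in>Q. norm (g (Sup K) - g (Inf K)) + \<bar>c\<bar> * (Sup K - Inf K))"
    proof -
      have "(\<Sum>(t, K)\<in>P. if t \<in> N then norm (g (Sup K) - g (Inf K)) + \<bar>c\<bar> * (Sup K - Inf K) else 0)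
          = (\<Sum>(t, K)\<in>Q. norm (g (Sup K) - g (Inf K)) + \<bar>c\<bar> * (Sup K - Inf K))"
        unfolding Q_def using td(1) by (intro sum.mono_neutral_cong_right) (auto split: if_splits)
      then show ?thesis by (simp add: split_def sum.distrib)
    qed
    also have "(\<Sum>(t, K)\<in>P. (c + \<epsilon>) * (Sup K - Inf K)) = (c + \<epsilon>) * (b - a)"
      using additive_tagged_division_1[OF \<open>a \<le> b\<close> P(1), of "\<lambda>x. x"]
      by (simp add: split_def flip: sum_distrib_left)
    also have "(\<Sum>(t, K)\<in>Q. norm (g (Sup K) - g (Inf K)) + \<bar>c\<bar> * (Sup K - Inf K))
        = (\<Sum>K\<in>snd ` Q. norm (g (Sup K) - g (Inf K))) + \<bar>c\<bar> * (\<Sum>K\<in>snd ` Q. Sup K - Inf K)"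
      by (subst reindex) (simp_all add: sum.distrib sum_distrib_left)
    also have "\<dots> \<le> \<epsilon> + \<epsilon>"
    proof (rule add_mono)
      have "0 \<le> (\<Sum>K\<in>snd ` Q. Sup K - Inf K)"
      proof (rule sum_nonneg)
        fix K assume "K \<in> snd ` Q"
        then obtain u v where "K = {u..v}" "u \<le> v" using Q_interval by blast
        then show "0 \<le> Sup K - Inf K" by simp
      qed
      then have "\<bar>c\<bar> * (\<Sum>K\<in>snd ` Q. Sup K - Inf K) \<le> (\<bar>c\<bar> + 1) * (\<epsilon> / (\<bar>c\<bar> + 1))"
        using len by (intro mult_mono) (auto simp: \<eta>_def)
      also have "\<dots> = \<epsilon>" by (simp add: field_simps)
      finally show "\<bar>c\<bar> * (\<Sum>K\<in>snd ` Q. Sup K - Inf K) \<le> \<epsilon>" .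
    qed (use var in simp)
    finally show ?thesis by (simp add: algebra_simps)
  qed
  show ?thesis
  proof (rule field_le_epsilon)
    fix e :: real assume "e > 0"
    then show "g b - g a \<le> c * (b - a) + e"
      using main[of "e / (b - a + 2)"] \<open>a \<le> b\<close> by simp
  qed
qed

lemma abs_continuous_imp_continuous_on:
  assumes "abs_continuous_on a b f"
  shows "continuous_on {a..b} f"
  unfolding continuous_on_iff
proof (intro ballI allI impI)
  fix t \<epsilon> :: real assume t: "t \<in> {a..b}" and "\<epsilon> > 0"
  from assms \<open>\<epsilon> > 0\<close> obtain \<delta> where "\<delta> > 0"
    and \<delta>_all: "\<forall>D. D division_of \<Union>D \<longrightarrow> \<Union>D \<subseteq> {a..b} \<longrightarrow>
      (\<Sum>K\<in>D. Sup K - Inf K) < \<delta> \<longrightarrow> (\<Sum>K\<in>D. norm (f (Sup K) - f (Inf K))) < \<epsilon>"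
    by (rule abs_continuous_onE)
  note \<delta> = \<delta>_all[rule_format]
  have *: "norm (f v - f u) < \<epsilon>" if "u \<in> {a..b}" "v \<in> {a..b}" "u \<le> v" "v - u < \<delta>" for u v
  proof -
    have "{cbox u v} division_of cbox u v" using that by (intro division_of_self) auto
    then show ?thesis using \<delta>[of "{cbox u v}"] that by (auto simp: cbox_interval)
  qed
  have "dist (f t') (f t) < \<epsilon>" if "t' \<in> {a..b}" "dist t' t < \<delta>" for t'
    using *[of t t'] *[of t' t] that t
    by (cases "t \<le> t'") (auto simp: dist_real_def dist_norm norm_minus_commute)
  then show "\<exists>d>0. \<forall>t'\<in>{a..b}. dist t' t < d \<longrightarrow> dist (f t') (f t) < \<epsilon>"
    using \<open>\<delta> > 0\<close> by blast
qed

text \<open>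
  If \<open>W T\<close> were nonzero, then \<open>W\<close> would decrease at rate \<open>\<kappa>\<close> from its last zero before \<open>T\<close> (or from
  \<open>t0\<close>, if there is no zero) up to \<open>T\<close>, and hence be at most zero there.
\<close>

lemma decay_to_zero_in_finite_time:
  fixes W :: "real \<Rightarrow> real"
  assumes ac: "\<And>a b. t0 \<le> a \<Longrightarrow> a \<le> b \<Longrightarrow> abs_continuous_on a b W"
    and nonneg: "\<And>t. W t \<ge> 0" and "\<kappa> > 0"
    and ae: "AE t in lebesgue. t0 < t \<and> W t \<noteq> 0 \<longrightarrow> (\<exists>d\<le>- \<kappa>. (W has_real_derivative d) (at t))"
    and T: "T \<ge> t0 + W t0 / \<kappa>"
  shows "W T = 0"
proof (rule ccontr)
  assume "W T \<noteq> 0"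
  have "t0 \<le> T" using T divide_nonneg_pos[OF nonneg[of t0] \<open>\<kappa> > 0\<close>] by linarith
  have decr: "W T - W a \<le> - \<kappa> * (T - a)" if "t0 \<le> a" "a \<le> T" "\<And>t. a < t \<Longrightarrow> t < T \<Longrightarrow> W t \<noteq> 0" for a
  proof (rule abs_continuous_increment_le)
    show "AE t in lebesgue. a < t \<and> t < T \<longrightarrow> (\<exists>d\<le>- \<kappa>. (W has_real_derivative d) (at t))"
      using ae by eventually_elim (use that in auto)
  qed (use that ac in auto)
  define Z where "Z = {t \<in> {t0..T}. W t = 0}"
  show False
  proof (cases "Z = {}")
    case True
    then have "W T - W t0 \<le> - \<kappa> * (T - t0)"
      using \<open>t0 \<le> T\<close> by (intro decr) (auto simp: Z_def)
    also have "\<dots> \<le> - W t0" using T \<open>\<kappa> > 0\<close> by (simp add: field_simps)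
    finally show False using nonneg[of T] \<open>W T \<noteq> 0\<close> by simp
  next
    case False
    have "continuous_on {t0..T} W"
      using ac \<open>t0 \<le> T\<close> by (intro abs_continuous_imp_continuous_on) auto
    then have "closed Z" unfolding Z_def by (intro continuous_closed_preimage_constant) auto
    then have "compact ({t0..T} \<inter> Z)" by (intro compact_Int_closed) auto
    moreover have "{t0..T} \<inter> Z = Z" by (auto simp: Z_def)
    ultimately obtain \<sigma> where \<sigma>: "\<sigma> \<in> Z" "\<And>t. t \<in> Z \<Longrightarrow> t \<le> \<sigma>"
      using compact_attains_sup[of Z] False by auto
    then have "W T - W \<sigma> \<le> - \<kappa> * (T - \<sigma>)"
    proof (intro decr)
      show "W t \<noteq> 0" if "\<sigma> < t" "t < T" for t
        using \<sigma>(1) \<sigma>(2)[of t] that by (auto simp: Z_def)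
    qed (use \<sigma>(1) in \<open>auto simp: Z_def\<close>)
    also have "- \<kappa> * (T - \<sigma>) \<le> 0"
      using \<sigma>(1) \<open>\<kappa> > 0\<close> by (simp add: Z_def)
    finally show False using nonneg[of T] \<open>W T \<noteq> 0\<close> \<sigma>(1) by (simp add: Z_def)
  qed
qed

section \<open>Extremal eigenvectors and the second root of the characteristic polynomial\<close>

lemma linear_le_quadratic_imp_zero:
  fixes b c :: real
  assumes "\<And>s. 0 \<le> 2 * s * b + s\<^sup>2 * c"
  shows "b = 0"
proof (rule ccontr)
  assume "b \<noteq> 0"
  define k where "k = \<bar>c\<bar> + 1"
  have "k > 0" "c \<le> k" by (auto simp: k_def)
  have "0 \<le> 2 * (- b / k) * b + (- b / k)\<^sup>2 * c" by (rule assms)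
  also have "(- b / k)\<^sup>2 * c \<le> (- b / k)\<^sup>2 * k" using \<open>c \<le> k\<close> by (rule mult_left_mono) simp
  also have "2 * (- b / k) * b + (- b / k)\<^sup>2 * k = - (b\<^sup>2 / k)"
    using \<open>k > 0\<close> by (simp add: field_simps power2_eq_square)
  finally show False using \<open>b \<noteq> 0\<close> \<open>k > 0\<close> by (simp add: divide_le_0_iff)
qed

lemma inner_matrix_vector_mult:
  fixes A :: "real^'n^'m"
  shows "x \<bullet> (A *v y) = (transpose A *v x) \<bullet> y"
  by (simp add: dot_lmul_matrix)

text \<open>
  A minimiser \<open>u\<close> of the quadratic form on the unit sphere of the hyperplane orthogonal to \<open>e\<close> is
  an eigenvector: the residual \<open>v = A u - \<mu> u\<close> lies in the hyperplane, because \<open>A e = 0\<close>. Along the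
  line \<open>u + s v\<close> the function \<open>x \<bullet> A x - \<mu> (norm x)\<^sup>2\<close> has its minimum at \<open>s = 0\<close>, where its
  first-order coefficient is \<open>2 (v \<bullet> v)\<close>; hence \<open>v = 0\<close>.
\<close>

lemma symmetric_matrix_least_eigenvector:
  fixes A :: "real^'n^'n" and e :: "real^'n"
  assumes sym: "transpose A = A" and ker: "A *v e = 0" and ne: "\<exists>u. u \<noteq> 0 \<and> u \<bullet> e = 0"
  obtains u \<mu> where "u \<noteq> 0" "u \<bullet> e = 0" "A *v u = \<mu> *\<^sub>R u"
    "\<And>x. x \<bullet> e = 0 \<Longrightarrow> \<mu> * (norm x)\<^sup>2 \<le> x \<bullet> (A *v x)"
proof -
  define S where "S = sphere 0 1 \<inter> {u :: real^'n. u \<bullet> e = 0}"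
  have "closed {u :: real^'n. u \<bullet> e = 0}"
    by (intro closed_Collect_eq continuous_intros)
  then have "compact S" unfolding S_def by (simp add: compact_Int_closed)
  obtain u0 :: "real^'n" where "u0 \<noteq> 0" "u0 \<bullet> e = 0" using ne by blast
  then have "(1 / norm u0) *\<^sub>R u0 \<in> S" by (simp add: S_def)
  then have "S \<noteq> {}" by blast
  have "continuous_on S (\<lambda>x. x \<bullet> (A *v x))"
    by (intro continuous_intros matrix_vector_mult_linear_continuous_on)
  then obtain u where u: "u \<in> S" and min: "\<And>x. x \<in> S \<Longrightarrow> u \<bullet> (A *v u) \<le> x \<bullet> (A *v x)"
    using continuous_attains_inf[OF \<open>compact S\<close> \<open>S \<noteq> {}\<close>] by blast
  define \<mu> where "\<mu> = u \<bullet> (A *v u)"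
  have u1: "norm u = 1" "u \<bullet> e = 0" using u by (auto simp: S_def)
  have low: "\<mu> * (norm x)\<^sup>2 \<le> x \<bullet> (A *v x)" if "x \<bullet> e = 0" for x
  proof (cases "x = 0")
    case False
    then have "(1 / norm x) *\<^sub>R x \<in> S" using that by (simp add: S_def)
    from min[OF this] have "\<mu> \<le> (x \<bullet> (A *v x)) / (norm x)\<^sup>2"
      by (simp add: \<mu>_def matrix_vector_mult_scaleR power2_eq_square)
    then show ?thesis using False by (simp add: field_simps)
  qed simp
  define v where "v = A *v u - \<mu> *\<^sub>R u"
  have "(A *v u) \<bullet> e = 0"
    using inner_matrix_vector_mult[of e A u] sym ker by (simp add: inner_commute)
  then have ve: "v \<bullet> e = 0" using u1 by (simp add: v_def inner_diff_left)
  have "v \<bullet> v = 0"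
  proof (rule linear_le_quadratic_imp_zero)
    fix s :: real
    have "(u + s *\<^sub>R v) \<bullet> (A *v (u + s *\<^sub>R v))
        = u \<bullet> (A *v u) + 2 * s * (v \<bullet> (A *v u)) + s\<^sup>2 * (v \<bullet> (A *v v))"
    proof -
      have "u \<bullet> (A *v v) = v \<bullet> (A *v u)"
        using inner_matrix_vector_mult[of u A v] sym by (simp only: inner_commute)
      then show ?thesis
        by (simp add: inner_add_left inner_add_right matrix_vector_right_distrib
          matrix_vector_mult_scaleR distrib_left power2_eq_square)
    qed
    moreover have "(norm (u + s *\<^sub>R v))\<^sup>2 = u \<bullet> u + 2 * s * (v \<bullet> u) + s\<^sup>2 * (v \<bullet> v)"
      unfolding power2_norm_eq_inner
      by (simp add: inner_add_left inner_add_right inner_commute[of u v] distrib_left power2_eq_square)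
    moreover have "u \<bullet> (A *v u) = \<mu> * (u \<bullet> u)"
      using u1 by (simp add: \<mu>_def norm_eq_1)
    moreover have "\<mu> * (norm (u + s *\<^sub>R v))\<^sup>2 \<le> (u + s *\<^sub>R v) \<bullet> (A *v (u + s *\<^sub>R v))"
      using u1 ve by (intro low) (simp add: inner_add_left)
    ultimately have "0 \<le> 2 * s * (v \<bullet> (A *v u) - \<mu> * (v \<bullet> u))
        + s\<^sup>2 * (v \<bullet> (A *v v) - \<mu> * (v \<bullet> v))"
      by (simp add: algebra_simps)
    also have "v \<bullet> (A *v u) - \<mu> * (v \<bullet> u) = v \<bullet> v"
      by (metis v_def inner_diff_right inner_scaleR_right)
    finally show "0 \<le> 2 * s * (v \<bullet> v) + s\<^sup>2 * (v \<bullet> (A *v v) - \<mu> * (v \<bullet> v))" .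
  qed
  then have "A *v u = \<mu> *\<^sub>R u" by (simp add: v_def)
  then show thesis using that[of u \<mu>] u1 low by fastforce
qed

lemma poly_charpoly: "poly (charpoly A) t = det (t *\<^sub>R mat 1 - A)"
proof -
  have "poly ((if i = j then [:0, 1:] else 0) - [:A $ i $ j:]) t = (t *\<^sub>R mat 1 - A) $ i $ j" for i j
    by (simp add: mat_def)
  then show ?thesis
    unfolding charpoly_def det_def by (simp add: poly_sum poly_prod poly_of_int)
qed

lemma eigenvector_imp_charpoly_root:
  fixes A :: "real^'n^'n"
  assumes "A *v u = t *\<^sub>R u" "u \<noteq> 0"
  shows "poly (charpoly A) t = 0"
proof -
  have "(t *\<^sub>R mat 1 - A) *v u = 0"
    using assms by (simp add: matrix_vector_mult_diff_rdistrib flip: scaleR_matrix_vector_assoc)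
  then have "\<not> invertible (t *\<^sub>R mat 1 - A)"
    using \<open>u \<noteq> 0\<close> matrix_left_invertible_ker[of "t *\<^sub>R mat 1 - A"] by (auto simp: invertible_def)
  then show ?thesis by (simp add: poly_charpoly invertible_det_nz)
qed

text \<open>
  At an argument above the operator norm of \<open>A\<close> the polynomial does not vanish. This is what makes
  its multiset of roots consist of its roots; for the zero polynomial that multiset is empty.
\<close>

lemma charpoly_nonzero:
  fixes A :: "real^'n^'n"
  shows "charpoly A \<noteq> 0"
proof -
  obtain K where K: "\<And>x. norm (A *v x) \<le> norm x * K"
    using bounded_linear.bounded[OF matrix_vector_mul_bounded_linear[of A]] by blast
  define t where "t = \<bar>K\<bar> + 1"
  have "x = 0" if "(t *\<^sub>R mat 1 - A) *v x = 0" for x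
  proof -
    have "A *v x = t *\<^sub>R x"
      using that by (simp add: matrix_vector_mult_diff_rdistrib flip: scaleR_matrix_vector_assoc)
    then have "t * norm x \<le> norm x * K" using K[of x] by (simp add: t_def)
    also have "norm x * K \<le> norm x * \<bar>K\<bar>" by (simp add: mult_left_mono)
    finally show "x = 0" by (simp add: t_def algebra_simps)
  qed
  then have "invertible (t *\<^sub>R mat 1 - A)"
    using matrix_left_invertible_ker[of "t *\<^sub>R mat 1 - A"] by (metis invertible_left_inverse)
  then have "poly (charpoly A) t \<noteq> 0" by (simp add: poly_charpoly invertible_det_nz)
  then show ?thesis by auto
qed

lemma lambda2_le:
  fixes A :: "real^'n^'n"
  assumes "poly (charpoly A) a = 0" "poly (charpoly A) b = 0" "a < b"
  shows "lambda2 A \<le> b"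
proof -
  define l where "l = eigenvalue_list A"
  have "sorted l" by (simp add: l_def eigenvalue_list_def)
  have "set l = {x. poly (charpoly A) x = 0}"
    by (simp add: l_def eigenvalue_list_def charpoly_nonzero)
  then obtain i j where ij: "i < length l" "l ! i = a" "j < length l" "l ! j = b"
    using assms by (auto simp: set_eq_iff in_set_conv_nth) metis
  then have "\<not> j \<le> i" using sorted_nth_mono[OF \<open>sorted l\<close>, of j i] \<open>a < b\<close> by auto
  then have "l ! 1 \<le> l ! j" using sorted_nth_mono[OF \<open>sorted l\<close>, of 1 j] ij by auto
  then show ?thesis using ij by (simp add: lambda2_def l_def)
qed

section \<open>Filippov sets and derivatives\<close>

text \<open>
  The condition on \<open>v\<close> cuts out a hyperplane, which is closed and convex and therefore absorbs the
  closed convex hull.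
\<close>

lemma filippov_map_inner:
  assumes "eventually (\<lambda>y. a \<bullet> f y = c) (nhds x)" and v: "v \<in> filippov_map f x"
  shows "a \<bullet> v = c"
proof -
  obtain \<delta> where "\<delta> > 0" and \<delta>: "\<And>y. y \<in> ball x \<delta> \<Longrightarrow> a \<bullet> f y = c"
    using assms(1) by (auto simp: eventually_nhds_metric dist_commute)
  have "v \<in> closure (convex hull (f ` (ball x \<delta> - {})))"
    using v \<open>\<delta> > 0\<close> unfolding filippov_map_def by blast
  also have "\<dots> \<subseteq> {u. a \<bullet> u = c}"
    using \<delta> by (intro closure_minimal hull_minimal closed_hyperplane convex_hyperplane) auto
  finally show ?thesis by simp
qed

lemma has_vector_derivative_vec_nth_iff:
  fixes f :: "real \<Rightarrow> real^'m"
  shows "(f has_vector_derivative f') (at t within S)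
    \<longleftrightarrow> (\<forall>i. ((\<lambda>t. f t $ i) has_vector_derivative f' $ i) (at t within S))"
  unfolding has_vector_derivative_def
  by (subst has_derivative_componentwise_within) (simp add: Basis_vec_def inner_axis)

lemma norm_has_real_derivative:
  fixes f :: "real \<Rightarrow> 'a::real_inner"
  assumes f: "(f has_vector_derivative f') (at t)" and "f t \<noteq> 0"
  shows "((\<lambda>s. norm (f s)) has_real_derivative (f t \<bullet> f' / norm (f t))) (at t)"
proof -
  have "((\<lambda>s. norm (f s)) has_derivative (\<lambda>h. (h *\<^sub>R f') \<bullet> sgn (f t))) (at t)"
    by (rule has_derivative_compose[OF f[unfolded has_vector_derivative_def]
          has_derivative_norm[OF \<open>f t \<noteq> 0\<close>]])
  moreover have "(\<lambda>h. (h *\<^sub>R f') \<bullet> sgn (f t)) = (*) (f t \<bullet> f' / norm (f t))"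
    by (rule ext) (simp add: sgn_div_norm inner_commute divide_inverse)
  ultimately show ?thesis by (simp only: has_field_derivative_def)
qed

section \<open>Stacked vectors\<close>

lemma transpose_kron_mat: "transpose (kron_mat A B) = kron_mat (transpose A) (transpose B)"
  by (simp add: vec_eq_iff transpose_def kron_mat_def)

lemma kron_mat_identity_mult_nth:
  fixes A :: "real^'c^'r" and x :: "real^('c \<times> 'k::finite)"
  shows "(kron_mat A (mat 1 :: real^'k^'k) *v x) $ (i, k) = (\<Sum>j\<in>UNIV. A $ i $ j * x $ (j, k))"
proof -
  have "(kron_mat A (mat 1 :: real^'k^'k) *v x) $ (i, k)
      = (\<Sum>(j, l)\<in>UNIV \<times> UNIV. A $ i $ j * (if k = l then 1 else 0) * x $ (j, l))"
    by (simp add: matrix_vector_mult_def kron_mat_def mat_def case_prod_beta)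
  also have "\<dots> = (\<Sum>j\<in>UNIV. \<Sum>l\<in>UNIV. if k = l then A $ i $ j * x $ (j, l) else 0)"
    unfolding sum.cartesian_product[symmetric] by (intro sum.cong refl) auto
  finally show ?thesis by simp
qed

text \<open>
  The entries of \<open>(B\<^sup>T \<otimes> I) x\<close>; see \<open>kron_incidence_transpose_mult_nth\<close>.
\<close>

definition arc_diff :: "('n, 'e) pre_digraph \<Rightarrow> real^('n::finite \<times> 'k::finite) \<Rightarrow> 'e \<times> 'k \<Rightarrow> real" where
  "arc_diff G x l = x $ (head G (fst l), snd l) - x $ (tail G (fst l), snd l)"

definition component :: "real^('n::finite \<times> 'k::finite) \<Rightarrow> 'k \<Rightarrow> real^'n" where
  "component x k = (\<chi> i. x $ (i, k))"

lemma arc_diff_add: "arc_diff G (x + y) l = arc_diff G x l + arc_diff G y l"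
  by (simp add: arc_diff_def)

lemma norm_le_sum_norm_component: "norm x \<le> (\<Sum>k\<in>UNIV. norm (component x k))"
proof -
  have "norm x = sqrt (\<Sum>(i, k)\<in>UNIV \<times> UNIV. (x $ (i, k))\<^sup>2)"
    by (simp add: norm_vec_def L2_set_def case_prod_beta)
  also have "\<dots> = sqrt (\<Sum>k\<in>UNIV. (norm (component x k))\<^sup>2)"
  proof -
    have "(norm (component x k))\<^sup>2 = (\<Sum>i\<in>UNIV. (x $ (i, k))\<^sup>2)" for k
      by (simp add: norm_vec_def L2_set_def component_def sum_nonneg)
    then show ?thesis
      unfolding sum.cartesian_product[symmetric] by (subst sum.swap) simp
  qed
  also have "\<dots> = L2_set (\<lambda>k. norm (component x k)) UNIV" by (simp add: L2_set_def)
  also have "\<dots> \<le> (\<Sum>k\<in>UNIV. norm (component x k))" by (rule L2_set_le_sum) simp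
  finally show ?thesis .
qed

lemma sum_abs_le_sqrt_card_norm:
  fixes x :: "real^'n"
  shows "(\<Sum>i\<in>UNIV. \<bar>x $ i\<bar>) \<le> sqrt (real CARD('n)) * norm x"
proof -
  have "(\<Sum>i\<in>UNIV. \<bar>1\<bar> * \<bar>x $ i\<bar>) \<le> L2_set (\<lambda>i. 1) (UNIV :: 'n set) * L2_set (($) x) UNIV"
    by (rule L2_set_mult_ineq)
  then show ?thesis by (simp add: L2_set_def norm_vec_def)
qed

text \<open>
  The orthogonal projection onto the vectors whose sum over the agents is zero.
\<close>

definition disagreement :: "real^('n::finite \<times> 'k::finite) \<Rightarrow> real^('n \<times> 'k)" where
  "disagreement x = (\<chi> m. x $ m - (\<Sum>i\<in>UNIV. x $ (i, snd m)) / real CARD('n))"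

lemma bounded_linear_disagreement: "bounded_linear disagreement"
  unfolding linear_conv_bounded_linear[symmetric]
  by (rule linearI)
    (auto simp: disagreement_def vec_eq_iff sum.distrib add_divide_distrib sum_distrib_left right_diff_distrib)

lemma sum_disagreement: "(\<Sum>i\<in>UNIV. disagreement x $ (i, k)) = 0"
  by (simp add: disagreement_def sum_subtractf)

lemma arc_diff_disagreement: "arc_diff G (disagreement x) l = arc_diff G x l"
  by (simp add: arc_diff_def disagreement_def)

lemma inner_disagreement:
  fixes a x :: "real^('n::finite \<times> 'k::finite)"
  assumes "\<And>k. (\<Sum>i\<in>UNIV. a $ (i, k)) = 0"
  shows "a \<bullet> disagreement x = a \<bullet> x"
proof -
  define c where "c k = (\<Sum>i\<in>UNIV. x $ (i, k)) / real CARD('n)" for k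
  have "a \<bullet> disagreement x = a \<bullet> x - (\<Sum>m\<in>UNIV. a $ m * c (snd m))"
    by (simp add: disagreement_def inner_vec_def right_diff_distrib sum_subtractf c_def)
  also have "(\<Sum>m\<in>UNIV. a $ m * c (snd m)) = (\<Sum>(i, k)\<in>UNIV \<times> UNIV. a $ (i, k) * c k)"
    by (simp add: case_prod_beta)
  also have "\<dots> = (\<Sum>k\<in>UNIV. (\<Sum>i\<in>UNIV. a $ (i, k)) * c k)"
    unfolding sum.cartesian_product[symmetric] by (subst sum.swap) (simp add: sum_distrib_right)
  finally show ?thesis using assms by simp
qed

section \<open>The Laplacian of a connected graph\<close>

locale simple_connected_graph = graph G for G :: "('n::finite, 'e::finite) pre_digraph" +
  assumes verts_UNIV: "verts G = UNIV" and arcs_UNIV: "arcs G = UNIV"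
    and connected: "Digraph_Component.connected G"
begin

lemma tail_neq_head: "tail G e \<noteq> head G e"
  using no_loops arcs_UNIV by auto

lemma arcs_ends_sym: "(i, j) \<in> arcs_ends G \<longleftrightarrow> (j, i) \<in> arcs_ends G"
  using arcs_ends_symmetric[OF sym_arcs] by blast

lemma sum_arcs_from:
  "(\<Sum>j\<in>UNIV. adjacency G $ i $ j * f j) = (\<Sum>e | tail G e = i. f (head G e) :: real)"
proof -
  have "(\<Sum>j\<in>UNIV. adjacency G $ i $ j * f j) = (\<Sum>j | (i, j) \<in> arcs_ends G. f j)"
    by (intro sum.mono_neutral_cong_right) (auto simp: adjacency_def)
  also have "{j. (i, j) \<in> arcs_ends G} = head G ` {e. tail G e = i}"
    by (auto simp: arcs_ends_conv arcs_UNIV)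
  also have "(\<Sum>j\<in>\<dots>. f j) = (\<Sum>e | tail G e = i. f (head G e))"
    using no_multi_arcs by (subst sum.reindex) (auto simp: inj_on_def arc_to_ends_def arcs_UNIV)
  finally show ?thesis .
qed

lemma sum_arcs_eq_sum_from: "(\<Sum>i\<in>UNIV. \<Sum>e | tail G e = i. f e) = (\<Sum>e\<in>UNIV. f e :: real)"
  using sum.group[of UNIV UNIV "tail G" f] by simp

lemma sum_arcs_reverse:
  "(\<Sum>e\<in>UNIV. f (tail G e) (head G e)) = (\<Sum>e\<in>UNIV. f (head G e) (tail G e) :: real)"
proof -
  have sym: "adjacency G $ i $ j = adjacency G $ j $ i" for i j
    using arcs_ends_sym[of i j] by (simp add: adjacency_def)
  have *: "(\<Sum>e\<in>UNIV. g (tail G e) (head G e)) = (\<Sum>i\<in>UNIV. \<Sum>j\<in>UNIV. adjacency G $ i $ j * g i j)"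
    for g :: "'n \<Rightarrow> 'n \<Rightarrow> real"
    unfolding sum_arcs_from by (subst sum_arcs_eq_sum_from[symmetric]) (auto intro!: sum.cong)
  show ?thesis
    unfolding *[of f] *[of "\<lambda>x y. f y x"] by (subst sum.swap) (simp add: sym)
qed

lemma laplacian_mult_nth: "(laplacian G *v u) $ i = (\<Sum>e | tail G e = i. u $ i - u $ head G e)"
proof -
  have "(laplacian G *v u) $ i
      = (\<Sum>j\<in>UNIV. adjacency G $ i $ j * u $ i) - (\<Sum>j\<in>UNIV. adjacency G $ i $ j * u $ j)"
    by (simp add: laplacian_def diag_mat_def matrix_vector_mult_def sum_subtractf sum_distrib_right
        left_diff_distrib if_distrib[where f = "\<lambda>x. x * _"] sum.delta cong: if_cong)
  then show ?thesis unfolding sum_arcs_from sum_subtractf .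
qed

lemma laplacian_symmetric: "transpose (laplacian G) = laplacian G"
  using arcs_ends_sym
  by (auto simp: vec_eq_iff transpose_def laplacian_def diag_mat_def adjacency_def)

text \<open>
  The factor \<open>1 / 2\<close> is due to each undirected edge being counted as two arcs.
\<close>

lemma laplacian_quadratic_form:
  "u \<bullet> (laplacian G *v u) = (\<Sum>e\<in>UNIV. (u $ tail G e - u $ head G e)\<^sup>2) / 2"
proof -
  have 1: "u \<bullet> (laplacian G *v u) = (\<Sum>e\<in>UNIV. u $ tail G e * (u $ tail G e - u $ head G e))"
    unfolding inner_vec_def laplacian_mult_nth
    by (subst sum_arcs_eq_sum_from[symmetric]) (auto simp: sum_distrib_left intro!: sum.cong)
  have 2: "\<dots> = (\<Sum>e\<in>UNIV. u $ head G e * (u $ head G e - u $ tail G e))"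
    using sum_arcs_reverse[of "\<lambda>i j. u $ i * (u $ i - u $ j)"] .
  have "(\<Sum>e\<in>UNIV. (u $ tail G e - u $ head G e)\<^sup>2)
      = (\<Sum>e\<in>UNIV. u $ tail G e * (u $ tail G e - u $ head G e))
        + (\<Sum>e\<in>UNIV. u $ head G e * (u $ head G e - u $ tail G e))"
    unfolding sum.distrib[symmetric] by (intro sum.cong refl) (simp add: power2_eq_square algebra_simps)
  then show ?thesis using 1 2 by linarith
qed

lemma constant_if_equal_along_arcs:
  assumes "\<And>e. u (tail G e) = u (head G e)"
  shows "u i = u j"
proof -
  have "i \<rightarrow>\<^sup>*\<^bsub>G\<^esub> j"
    using connected sym_arcs verts_UNIV
    by (auto simp: connected_def reachable_mk_symmetric_eq elim!: strongly_connectedE)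
  then show ?thesis
    by (induction rule: reachable_induct) (use assms in \<open>auto simp: arcs_ends_conv\<close>)
qed

text \<open>
  The least eigenvalue \<open>\<mu>\<close> on the complement of the ones vector is positive, since a vector on which
  the quadratic form vanishes is constant along arcs, hence constant. So \<open>0\<close> and \<open>\<mu>\<close> are distinct
  roots of the characteristic polynomial, \<open>\<lambda>\<^sub>2 \<le> \<mu>\<close>, and the Cauchy-Schwarz inequality turns the bound
  on the quadratic form into one on the norm.
\<close>

lemma lambda2_norm_le_norm_laplacian:
  assumes card: "2 \<le> CARD('n)" and x0: "(\<Sum>i\<in>UNIV. x $ i) = 0"
  shows "lambda2 (laplacian G) * norm x \<le> norm (laplacian G *v x)"
proof -
  have perp: "u \<bullet> 1 = (\<Sum>i\<in>UNIV. u $ i)" for u :: "real^'n"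
    by (simp add: inner_vec_def)
  have ker: "laplacian G *v 1 = 0" by (simp add: vec_eq_iff laplacian_mult_nth)
  obtain i j :: 'n where "i \<noteq> j"
    using card card_le_Suc0_iff_eq[of "UNIV :: 'n set"] by fastforce
  then have "axis i 1 - axis j 1 \<noteq> (0 :: real^'n)" "(axis i 1 - axis j 1 :: real^'n) \<bullet> 1 = 0"
    by (auto simp: axis_eq_axis inner_diff_left inner_axis')
  then have "\<exists>u :: real^'n. u \<noteq> 0 \<and> u \<bullet> 1 = 0" by blast
  from symmetric_matrix_least_eigenvector[OF laplacian_symmetric ker this]
  obtain u \<mu> where u: "u \<noteq> 0" "u \<bullet> 1 = 0" "laplacian G *v u = \<mu> *\<^sub>R u"
    and low: "\<And>x. x \<bullet> 1 = 0 \<Longrightarrow> \<mu> * (norm x)\<^sup>2 \<le> x \<bullet> (laplacian G *v x)" by blast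
  have q: "\<mu> * (norm u)\<^sup>2 = (\<Sum>e\<in>UNIV. (u $ tail G e - u $ head G e)\<^sup>2) / 2"
    using laplacian_quadratic_form[of u] u by (simp add: power2_norm_eq_inner)
  have "\<mu> > 0"
  proof (rule ccontr)
    assume "\<not> \<mu> > 0"
    then have "\<mu> * (norm u)\<^sup>2 \<le> 0" by (simp add: mult_nonpos_nonneg)
    then have "(\<Sum>e\<in>UNIV. (u $ tail G e - u $ head G e)\<^sup>2) = 0"
      using q by (intro antisym sum_nonneg) auto
    then have "u $ tail G e = u $ head G e" for e
      by (simp add: sum_nonneg_eq_0_iff)
    then have "u $ k = u $ i" for k using constant_if_equal_along_arcs[of "($) u"] by blast
    then obtain c where c: "\<And>k. u $ k = c" by blast
    then have "real CARD('n) * c = 0" using u(2) by (simp add: perp)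
    then show False using u(1) c by (simp add: vec_eq_iff)
  qed
  moreover have "(1 :: real^'n) \<noteq> 0" by (simp add: vec_eq_iff)
  ultimately have "lambda2 (laplacian G) \<le> \<mu>"
    using eigenvector_imp_charpoly_root[of "laplacian G" 1 0] ker
      eigenvector_imp_charpoly_root[OF u(3,1)] by (intro lambda2_le[of _ 0]) auto
  then have "lambda2 (laplacian G) * (norm x)\<^sup>2 \<le> \<mu> * (norm x)\<^sup>2" by (simp add: mult_right_mono)
  also have "\<dots> \<le> x \<bullet> (laplacian G *v x)" using x0 by (intro low) (simp add: perp)
  also have "\<dots> \<le> norm x * norm (laplacian G *v x)" by (rule norm_cauchy_schwarz)
  finally show ?thesis
    by (cases "x = 0") (simp_all add: power2_eq_square)
qed

text \<open>
  Bounding the 1-norm of \<open>B\<^sup>T x\<close> below by its 2-norm would give the rate \<open>sqrt (2 * \<lambda>\<^sub>2)\<close>, which is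
  smaller than \<open>\<lambda>\<^sub>2\<close> once \<open>\<lambda>\<^sub>2 > 2\<close>. Grouping the arcs by their tails gives the rate \<open>\<lambda>\<^sub>2\<close> itself.
\<close>

lemma norm_laplacian_le_sum_arcs:
  "norm (laplacian G *v x) \<le> (\<Sum>e\<in>UNIV. \<bar>x $ head G e - x $ tail G e\<bar>)"
proof -
  have "norm (laplacian G *v x) \<le> (\<Sum>i\<in>UNIV. \<bar>(laplacian G *v x) $ i\<bar>)" by (rule norm_le_l1_cart)
  also have "\<dots> \<le> (\<Sum>i\<in>UNIV. \<Sum>e | tail G e = i. \<bar>x $ head G e - x $ tail G e\<bar>)"
    unfolding laplacian_mult_nth
    by (intro sum_mono order_trans[OF sum_abs]) (auto simp: abs_minus_commute)
  also have "\<dots> = (\<Sum>e\<in>UNIV. \<bar>x $ head G e - x $ tail G e\<bar>)" by (rule sum_arcs_eq_sum_from)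
  finally show ?thesis .
qed

section \<open>Finite-time consensus\<close>

lemma kron_incidence_transpose_mult_nth:
  "(kron_mat (transpose (incidence G)) (mat 1 :: real^'k^'k) *v x) $ l = arc_diff G x l"
proof (cases l)
  case (Pair e k)
  have "(kron_mat (transpose (incidence G)) (mat 1 :: real^'k^'k) *v x) $ (e, k)
      = (\<Sum>i\<in>UNIV. (if head G e = i then x $ (i, k) else 0) - (if tail G e = i then x $ (i, k) else 0))"
    unfolding kron_mat_identity_mult_nth
    using tail_neq_head[of e] by (intro sum.cong) (auto simp: transpose_def incidence_def)
  then show ?thesis by (simp add: Pair sum_subtractf arc_diff_def)
qed

lemma consensus_field_inner:
  "a \<bullet> consensus_field G \<beta> \<phi> t y = - \<beta> * (\<Sum>l\<in>UNIV. arc_diff G a l * sgn (arc_diff G (y + \<phi> t) l))"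
proof -
  have "a \<bullet> (kron_mat (incidence G) (mat 1 :: real^6^6) *v s)
      = (\<Sum>l\<in>UNIV. arc_diff G a l * s $ l)" for s
    unfolding inner_matrix_vector_mult transpose_kron_mat transpose_mat
    by (simp add: inner_vec_def kron_incidence_transpose_mult_nth)
  then show ?thesis
    by (simp add: consensus_field_def sgn_vec_def kron_incidence_transpose_mult_nth)
qed

text \<open>
  Near \<open>w\<close> the sign of a nonzero coordinate of \<open>(B\<^sup>T \<otimes> I) (w + \<phi> t)\<close> is constant, and the other
  coordinates have weight zero in \<open>a\<close>. So the field has the same inner product with \<open>a\<close> throughout a
  neighbourhood. The lemma serves for \<open>a\<close> the disagreement, where all differences agree, and for
  \<open>a\<close> a consensus vector, where all of them vanish.
\<close>

lemma consensus_filippov_inner: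
  assumes v: "v \<in> filippov_map (consensus_field G \<beta> \<phi> t) w"
    and a: "\<And>l. arc_diff G a l \<noteq> 0 \<Longrightarrow> arc_diff G a l = arc_diff G (w + \<phi> t) l"
  shows "a \<bullet> v = - \<beta> * (\<Sum>l\<in>UNIV. \<bar>arc_diff G a l\<bar>)"
proof (rule filippov_map_inner[OF _ v])
  have "eventually (\<lambda>y. arc_diff G a l * sgn (arc_diff G (y + \<phi> t) l) = \<bar>arc_diff G a l\<bar>) (nhds w)" for l
  proof (cases "arc_diff G a l = 0")
    case False
    then have "arc_diff G (w + \<phi> t) l \<noteq> 0" using a[OF False] by simp
    have lim: "((\<lambda>y. arc_diff G (y + \<phi> t) l) \<longlongrightarrow> arc_diff G (w + \<phi> t) l) (nhds w)"
      unfolding arc_diff_def by (intro tendsto_intros filterlim_ident)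
    show ?thesis
    proof (cases "arc_diff G (w + \<phi> t) l > 0")
      case True
      from order_tendstoD(1)[OF lim this] show ?thesis
        by eventually_elim (use a[OF False] True in simp)
    next
      case neg: False
      then have "arc_diff G (w + \<phi> t) l < 0" using \<open>arc_diff G (w + \<phi> t) l \<noteq> 0\<close> by simp
      from order_tendstoD(2)[OF lim this] show ?thesis
        by eventually_elim (use a[OF False] neg in simp)
    qed
  qed simp
  then have "eventually (\<lambda>y. \<forall>l. arc_diff G a l * sgn (arc_diff G (y + \<phi> t) l) = \<bar>arc_diff G a l\<bar>) (nhds w)"
    by (simp add: eventually_all_finite)
  then show "eventually (\<lambda>y. a \<bullet> consensus_field G \<beta> \<phi> t y = - \<beta> * (\<Sum>l\<in>UNIV. \<bar>arc_diff G a l\<bar>)) (nhds w)"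
    by eventually_elim (simp only: consensus_field_inner)
qed

lemma lambda2_norm_component_le:
  assumes "2 \<le> CARD('n)" and "(\<Sum>i\<in>UNIV. x $ (i, k)) = 0"
  shows "lambda2 (laplacian G) * norm (component x k) \<le> (\<Sum>e\<in>UNIV. \<bar>arc_diff G x (e, k)\<bar>)"
  using order_trans[OF lambda2_norm_le_norm_laplacian[of "component x k"] norm_laplacian_le_sum_arcs] assms
  by (simp add: component_def arc_diff_def)

lemma sum_arcs_components:
  "(\<Sum>l\<in>UNIV. \<bar>arc_diff G x l\<bar>) = (\<Sum>k\<in>UNIV. \<Sum>e\<in>UNIV. \<bar>arc_diff G x (e, k)\<bar>)"
  by (subst sum.swap) (simp add: sum.cartesian_product)

lemma lambda2_norm_le_sum_arc_diff:
  assumes "2 \<le> CARD('n)" and "0 \<le> lambda2 (laplacian G)" and "\<And>k. (\<Sum>i\<in>UNIV. x $ (i, k)) = 0"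
  shows "lambda2 (laplacian G) * norm x \<le> (\<Sum>l\<in>UNIV. \<bar>arc_diff G x l\<bar>)"
proof -
  have "lambda2 (laplacian G) * norm x \<le> lambda2 (laplacian G) * (\<Sum>k\<in>UNIV. norm (component x k))"
    using assms(2) by (intro mult_left_mono norm_le_sum_norm_component)
  also have "\<dots> \<le> (\<Sum>k\<in>UNIV. \<Sum>e\<in>UNIV. \<bar>arc_diff G x (e, k)\<bar>)"
    unfolding sum_distrib_left using assms by (intro sum_mono lambda2_norm_component_le) auto
  finally show ?thesis unfolding sum_arcs_components .
qed

text \<open>
  The Cauchy-Schwarz inequality is applied to each component separately, in dimension \<open>n\<close>, so the
  constant is \<open>sqrt n\<close>, independent of the number of components.
\<close>

lemma lambda2_sum_abs_le_sum_arc_diff: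
  assumes "2 \<le> CARD('n)" and "0 \<le> lambda2 (laplacian G)" and "\<And>k. (\<Sum>i\<in>UNIV. x $ (i, k)) = 0"
  shows "lambda2 (laplacian G) * (\<Sum>m\<in>UNIV. \<bar>x $ m\<bar>)
    \<le> sqrt (real CARD('n)) * (\<Sum>l\<in>UNIV. \<bar>arc_diff G x l\<bar>)"
proof -
  have "(\<Sum>m\<in>UNIV. \<bar>x $ m\<bar>) = (\<Sum>k\<in>UNIV. \<Sum>i\<in>UNIV. \<bar>component x k $ i\<bar>)"
    by (subst sum.swap) (simp add: sum.cartesian_product component_def)
  also have "\<dots> \<le> (\<Sum>k\<in>UNIV. sqrt (real CARD('n)) * norm (component x k))"
    by (intro sum_mono sum_abs_le_sqrt_card_norm)
  finally have "lambda2 (laplacian G) * (\<Sum>m\<in>UNIV. \<bar>x $ m\<bar>)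
      \<le> lambda2 (laplacian G) * (\<Sum>k\<in>UNIV. sqrt (real CARD('n)) * norm (component x k))"
    using assms(2) by (rule mult_left_mono)
  also have "\<dots> = sqrt (real CARD('n)) * (\<Sum>k\<in>UNIV. lambda2 (laplacian G) * norm (component x k))"
    by (simp add: sum_distrib_left mult_ac)
  also have "\<dots> \<le> sqrt (real CARD('n)) * (\<Sum>l\<in>UNIV. \<bar>arc_diff G x l\<bar>)"
    unfolding sum_arcs_components
    using assms by (intro mult_left_mono sum_mono lambda2_norm_component_le) auto
  finally show ?thesis .
qed



text \<open>
  The sum is the inner product with a vector \<open>a\<close> that has no differences along arcs, so its
  derivative vanishes almost everywhere.
\<close>

lemma consensus_conserves_sum:
  assumes sol: "filippov_solution (consensus_field G \<beta> \<phi>) t0 w" and "t0 \<le> t"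
  shows "(\<Sum>i\<in>UNIV. w t $ (i, k)) = (\<Sum>i\<in>UNIV. w t0 $ (i, k))"
proof -
  define a :: "real^('n \<times> 6)" where "a = (\<chi> m. if snd m = k then 1 else 0)"
  have a_inner: "a \<bullet> x = (\<Sum>i\<in>UNIV. x $ (i, k))" for x
  proof -
    have "a \<bullet> x = (\<Sum>(i, l)\<in>UNIV \<times> UNIV. if l = k then x $ (i, l) else 0)"
      by (auto simp: a_def inner_vec_def case_prod_beta intro!: sum.cong)
    then show ?thesis unfolding sum.cartesian_product[symmetric] by simp
  qed
  \<comment> \<open>Monotonicity is used for both signs of \<open>c\<close> to obtain equality.\<close>
  have bound: "c * (a \<bullet> w t) - c * (a \<bullet> w t0) \<le> 0 * (t - t0)" for c :: real
  proof (rule abs_continuous_increment_le)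
    have "abs_continuous_on t0 t w" using assms by (simp add: filippov_solution_def)
    then show "abs_continuous_on t0 t (\<lambda>t. c * (a \<bullet> w t))"
    proof (rule abs_continuous_on_dominated[where B = "\<bar>c\<bar> * norm a" and C = 0])
      fix r s
      have "c * (a \<bullet> w s) - c * (a \<bullet> w r) = c * (a \<bullet> (w s - w r))"
        by (simp add: inner_diff_right right_diff_distrib)
      then show "norm (c * (a \<bullet> w s) - c * (a \<bullet> w r)) \<le> \<bar>c\<bar> * norm a * norm (w s - w r) + 0 * \<bar>s - r\<bar>"
        by (simp add: abs_mult mult.assoc mult_left_mono Cauchy_Schwarz_ineq2)
    qed
    have "AE t in lebesgue. t0 \<le> t \<longrightarrow> (\<exists>w'. (w has_vector_derivative w') (at t) \<and>
        w' \<in> filippov_map (consensus_field G \<beta> \<phi> t) (w t))"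
      using sol by (simp add: filippov_solution_def)
    then show "AE s in lebesgue. t0 < s \<and> s < t \<longrightarrow>
        (\<exists>d\<le>0. ((\<lambda>t. c * (a \<bullet> w t)) has_real_derivative d) (at s))"
    proof eventually_elim
      case (elim s)
      show ?case
      proof
        assume "t0 < s \<and> s < t"
        then obtain w' where w': "(w has_vector_derivative w') (at s)"
          "w' \<in> filippov_map (consensus_field G \<beta> \<phi> s) (w s)" using elim by auto
        have "arc_diff G a l = 0" for l by (simp add: arc_diff_def a_def)
        then have "a \<bullet> w' = 0" using consensus_filippov_inner[OF w'(2), of a] by simp
        moreover have "((\<lambda>t. c * (a \<bullet> w t)) has_vector_derivative c * (a \<bullet> w')) (at s)"
          by (rule bounded_linear.has_vector_derivative[OF
              bounded_linear_const_mult[OF bounded_linear_inner_right] w'(1)])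
        ultimately show "\<exists>d\<le>0. ((\<lambda>t. c * (a \<bullet> w t)) has_real_derivative d) (at s)"
          by (auto simp: has_real_derivative_iff_has_vector_derivative)
      qed
    qed
  qed fact
  show ?thesis using bound[of 1] bound[of "-1"] by (simp add: a_inner)
qed

theorem consensus_in_finite_time:
  fixes \<phi> \<phi>' :: "real \<Rightarrow> real^('n \<times> 6)"
  assumes card: "2 \<le> CARD('n)" and l2: "0 < lambda2 (laplacian G)"
    and deriv: "\<And>t. t0 \<le> t \<Longrightarrow> (\<phi> has_vector_derivative \<phi>' t) (at t within {t0..})"
    and bound: "\<And>t m. t0 \<le> t \<Longrightarrow> \<bar>\<phi>' t $ m\<bar> \<le> \<gamma>"
    and \<beta>: "1 + \<gamma> * sqrt (real CARD('n)) / lambda2 (laplacian G) \<le> \<beta>"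
    and sol: "filippov_solution (consensus_field G \<beta> \<phi>) t0 w"
    and init: "\<And>k. (\<Sum>i\<in>UNIV. w t0 $ (i, k)) = 0"
  defines "e \<equiv> \<lambda>t. w t + disagreement (\<phi> t)"
  assumes t: "t \<ge> t0 + norm (e t0) / lambda2 (laplacian G)"
  shows "e t = 0"
proof -
  let ?\<kappa> = "lambda2 (laplacian G)"
  have d_deriv: "((\<lambda>t. disagreement (\<phi> t)) has_vector_derivative disagreement (\<phi>' t)) (at t within {t0..})"
    if "t0 \<le> t" for t
    using bounded_linear.has_vector_derivative[OF bounded_linear_disagreement deriv[OF that]] .
  obtain M where M: "M > 0" "\<And>x. norm (disagreement x :: real^('n \<times> 6)) \<le> norm x * M"
    using bounded_linear.pos_bounded[OF bounded_linear_disagreement] by blast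
  define C where "C = (\<Sum>m\<in>(UNIV :: ('n \<times> 6) set). \<gamma>) * M"
  have lip: "norm (disagreement (\<phi> r) - disagreement (\<phi> s)) \<le> C * norm (r - s)" if "t0 \<le> r" "t0 \<le> s" for r s
  proof (rule differentiable_bound[of "{t0..}"])
    fix u assume u: "u \<in> {t0..}"
    then show "((\<lambda>t. disagreement (\<phi> t)) has_derivative (\<lambda>h. h *\<^sub>R disagreement (\<phi>' u))) (at u within {t0..})"
      using d_deriv by (simp add: has_vector_derivative_def)
    have "norm (\<phi>' u) \<le> (\<Sum>m\<in>UNIV. \<bar>\<phi>' u $ m\<bar>)" by (rule norm_le_l1_cart)
    also have "\<dots> \<le> (\<Sum>m\<in>(UNIV :: ('n \<times> 6) set). \<gamma>)"
      using u by (intro sum_mono bound) auto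
    finally have "norm (\<phi>' u) \<le> (\<Sum>m\<in>(UNIV :: ('n \<times> 6) set). \<gamma>)" .
    then have le: "norm (disagreement (\<phi>' u)) \<le> C"
      unfolding C_def using M(1) by (intro order_trans[OF M(2)] mult_right_mono) auto
    show "onorm (\<lambda>h. h *\<^sub>R disagreement (\<phi>' u)) \<le> C"
    proof (rule onorm_bound)
      show "0 \<le> C" by (rule order_trans[OF norm_ge_zero le])
      show "norm (h *\<^sub>R disagreement (\<phi>' u)) \<le> C * norm h" for h
        using mult_right_mono[OF le, of "norm h"] by (simp add: mult.commute)
    qed
  qed (use that in auto)
  have sum0: "(\<Sum>i\<in>UNIV. e s $ (i, k)) = 0" if "t0 \<le> s" for s k
    using consensus_conserves_sum[OF sol that, of k] init[of k]
    by (simp add: e_def sum.distrib sum_disagreement)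
  have "norm (e t) = 0"
  proof (rule decay_to_zero_in_finite_time[of t0 "\<lambda>t. norm (e t)" ?\<kappa>])
    fix a b assume "t0 \<le> a" "a \<le> b"
    then have "abs_continuous_on a b w" using sol by (simp add: filippov_solution_def)
    then show "abs_continuous_on a b (\<lambda>t. norm (e t))"
    proof (rule abs_continuous_on_dominated[where B = 1 and C = C])
      fix r s assume "r \<in> {a..b}" "s \<in> {a..b}"
      then have "norm (disagreement (\<phi> s) - disagreement (\<phi> r)) \<le> C * \<bar>s - r\<bar>"
        using lip[of s r] \<open>t0 \<le> a\<close> by simp
      moreover have "norm (norm (e s) - norm (e r)) \<le> norm (e s - e r)"
        using norm_triangle_ineq3 by simp
      moreover have "e s - e r = (w s - w r) + (disagreement (\<phi> s) - disagreement (\<phi> r))"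
        by (simp add: e_def)
      ultimately show "norm (norm (e s) - norm (e r)) \<le> 1 * norm (w s - w r) + C * \<bar>s - r\<bar>"
        using norm_triangle_ineq[of "w s - w r" "disagreement (\<phi> s) - disagreement (\<phi> r)"] by simp
    qed
  next
    have "AE t in lebesgue. t0 \<le> t \<longrightarrow> (\<exists>w'. (w has_vector_derivative w') (at t) \<and>
        w' \<in> filippov_map (consensus_field G \<beta> \<phi> t) (w t))"
      using sol by (simp add: filippov_solution_def)
    then show "AE t in lebesgue. t0 < t \<and> norm (e t) \<noteq> 0 \<longrightarrow>
        (\<exists>d\<le>- ?\<kappa>. ((\<lambda>t. norm (e t)) has_real_derivative d) (at t))"
    proof eventually_elim
      case (elim s)
      show ?case
      proof
        assume s: "t0 < s \<and> norm (e s) \<noteq> 0"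
        then obtain w' where w': "(w has_vector_derivative w') (at s)"
          "w' \<in> filippov_map (consensus_field G \<beta> \<phi> s) (w s)" using elim by auto
        let ?e' = "w' + disagreement (\<phi>' s)"
        have "at s within {t0..} = at s" using s by (intro at_within_interior) auto
        then have "(e has_vector_derivative ?e') (at s)"
          unfolding e_def using d_deriv[of s] s w'(1) by (auto intro: has_vector_derivative_add)
        then have nd: "((\<lambda>t. norm (e t)) has_real_derivative (e s \<bullet> ?e' / norm (e s))) (at s)"
          using s by (intro norm_has_real_derivative) auto
        define S where "S = (\<Sum>l\<in>UNIV. \<bar>arc_diff G (e s) l\<bar>)"
        have "S \<ge> 0" by (simp add: S_def sum_nonneg)
        have "e s \<bullet> w' = - \<beta> * S"
          unfolding S_def by (rule consensus_filippov_inner[OF w'(2)])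
            (simp add: e_def arc_diff_add arc_diff_disagreement)
        moreover have "e s \<bullet> disagreement (\<phi>' s) = e s \<bullet> \<phi>' s"
          using s by (intro inner_disagreement sum0) auto
        moreover have "e s \<bullet> \<phi>' s \<le> (\<gamma> * sqrt (real CARD('n)) / ?\<kappa>) * S"
        proof -
          \<comment> \<open>Any index shows that \<open>\<gamma>\<close> is nonnegative.\<close>
          have "\<gamma> \<ge> 0" using bound[of s "(undefined, 1)"] s by simp
          have "e s \<bullet> \<phi>' s \<le> (\<Sum>m\<in>UNIV. \<bar>e s $ m\<bar> * \<gamma>)"
            unfolding inner_vec_def
          proof (rule sum_mono)
            fix m
            have "e s $ m * \<phi>' s $ m \<le> \<bar>e s $ m\<bar> * \<bar>\<phi>' s $ m\<bar>" by (metis abs_ge_self abs_mult)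
            also have "\<dots> \<le> \<bar>e s $ m\<bar> * \<gamma>" using bound[of s m] s by (intro mult_left_mono) auto
            finally show "e s $ m \<bullet> \<phi>' s $ m \<le> \<bar>e s $ m\<bar> * \<gamma>" by simp
          qed
          also have "\<dots> = (\<Sum>m\<in>UNIV. \<bar>e s $ m\<bar>) * \<gamma>" by (rule sum_distrib_right[symmetric])
          also have "\<dots> = \<gamma> * (?\<kappa> * (\<Sum>m\<in>UNIV. \<bar>e s $ m\<bar>)) / ?\<kappa>"
            using l2 by simp
          also have "\<dots> \<le> \<gamma> * (sqrt (real CARD('n)) * S) / ?\<kappa>"
            unfolding S_def using l2 s \<open>\<gamma> \<ge> 0\<close> sum0 card
            by (intro divide_right_mono mult_left_mono lambda2_sum_abs_le_sum_arc_diff) auto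
          finally show ?thesis by (simp add: mult_ac)
        qed
        moreover have "(1 + \<gamma> * sqrt (real CARD('n)) / ?\<kappa>) * S \<le> \<beta> * S"
          using \<beta> \<open>S \<ge> 0\<close> by (rule mult_right_mono)
        ultimately have "e s \<bullet> ?e' \<le> - S" by (simp add: inner_add_right distrib_right)
        also have "- S \<le> - (?\<kappa> * norm (e s))"
          unfolding S_def using s card l2 sum0
          by (simp add: lambda2_norm_le_sum_arc_diff)
        finally have "e s \<bullet> ?e' / norm (e s) \<le> - ?\<kappa>" using s by (simp add: field_simps)
        then show "\<exists>d\<le>- ?\<kappa>. ((\<lambda>t. norm (e t)) has_real_derivative d) (at s)" using nd by blast
      qed
    qed
  qed (use l2 t in auto)
  then show ?thesis by simp
qed


end

section \<open>Least squares from averaged regressors\<close>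

lemma matrix_inv_inverse:
  assumes "invertible A"
  shows matrix_inv_right: "A ** matrix_inv A = mat 1" and matrix_inv_left: "matrix_inv A ** A = mat 1"
  using someI_ex[OF assms[unfolded invertible_def]] by (auto simp: matrix_inv_def)

lemma gram_matrix_ker:
  fixes H :: "real^'m^'n"
  assumes "(transpose H ** H) *v y = 0"
  shows "H *v y = 0"
proof -
  have "(H *v y) \<bullet> (H *v y) = y \<bullet> ((transpose H ** H) *v y)"
    by (simp only: inner_matrix_vector_mult[of y "transpose H"] transpose_transpose flip: matrix_vector_mul_assoc)
  then show ?thesis using assms by simp
qed

lemma gram_matrix_invertible:
  fixes H :: "real^'m^'n"
  assumes "rank H = CARD('m)"
  shows "invertible (transpose H ** H)"
proof -
  have "y = 0" if "(transpose H ** H) *v y = 0" for y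
    using gram_matrix_ker[OF that] assms matrix_vector_mult_0_right[of H]
    unfolding full_rank_injective inj_def by metis
  then show ?thesis
    using matrix_left_invertible_ker[of "transpose H ** H"] by (metis invertible_left_inverse)
qed

text \<open>
  The normal equations make the residual at \<open>q\<close> orthogonal to the range of \<open>H\<close>, so the residual at
  \<open>y\<close> exceeds it by \<open>H (y - q)\<close> in the sense of Pythagoras.
\<close>

lemma least_squares_unique_minimizer:
  fixes H :: "real^'m^'n" and z :: "real^'n"
  assumes inv: "invertible (transpose H ** H)"
  defines "q \<equiv> (matrix_inv (transpose H ** H) ** transpose H) *v z"
  shows "{y. is_arg_min (\<lambda>y. 1/2 * (norm (z - H *v y))\<^sup>2) (\<lambda>_. True) y} = {q}"
proof -
  have "(transpose H ** H) *v q = transpose H *v z"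
    using matrix_inv_right[OF inv] by (simp add: q_def matrix_vector_mul_assoc matrix_mul_assoc)
  then have normal: "transpose H *v (z - H *v q) = 0"
    by (simp add: matrix_vector_mult_diff_distrib flip: matrix_vector_mul_assoc)
  have pyth: "(norm (z - H *v y))\<^sup>2 = (norm (z - H *v q))\<^sup>2 + (norm (H *v (y - q)))\<^sup>2" for y
  proof -
    have "(z - H *v q) \<bullet> (H *v (q - y)) = 0"
      unfolding inner_matrix_vector_mult normal by simp
    then have "(norm ((z - H *v q) + H *v (q - y)))\<^sup>2
        = (norm (z - H *v q))\<^sup>2 + (norm (H *v (q - y)))\<^sup>2"
      by (intro norm_add_Pythagorean) (simp add: orthogonal_def)
    moreover have "(z - H *v q) + H *v (q - y) = z - H *v y"
      unfolding matrix_vector_mult_diff_distrib by simp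
    moreover have "norm (H *v (q - y)) = norm (H *v (y - q))"
      unfolding matrix_vector_mult_diff_distrib by (rule norm_minus_commute)
    ultimately show ?thesis by simp
  qed
  have inj: "y = q" if "H *v (y - q) = 0" for y
  proof -
    have "(transpose H ** H) *v (y - q) = 0" using that by (simp flip: matrix_vector_mul_assoc)
    then have "matrix_inv (transpose H ** H) *v ((transpose H ** H) *v (y - q)) = 0" by simp
    then show ?thesis by (simp add: matrix_vector_mul_assoc matrix_inv_left[OF inv])
  qed
  show ?thesis
  proof (intro set_eqI iffI)
    fix y assume "y \<in> {y. is_arg_min (\<lambda>y. 1/2 * (norm (z - H *v y))\<^sup>2) (\<lambda>_. True) y}"
    then have "(norm (z - H *v y))\<^sup>2 \<le> (norm (z - H *v q))\<^sup>2"
      by (auto simp: is_arg_min_linorder)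
    then have "(norm (H *v (y - q)))\<^sup>2 \<le> 0" using pyth[of y] by linarith
    then show "y \<in> {q}" using inj by simp
  next
    fix y assume "y \<in> {q}"
    moreover have "(norm (z - H *v q))\<^sup>2 \<le> (norm (z - H *v x))\<^sup>2" for x
      using pyth[of x] zero_le_power2[of "norm (H *v (x - q))"] by linarith
    ultimately show "y \<in> {y. is_arg_min (\<lambda>y. 1/2 * (norm (z - H *v y))\<^sup>2) (\<lambda>_. True) y}"
      by (simp add: is_arg_min_linorder)
  qed
qed

text \<open>
  Each agent knows the normal equations only up to the common factor \<open>1 / n\<close>, which this cancels.
\<close>

lemma matrix_inv_scaled_mult:
  fixes M :: "real^'m^'m"
  assumes "c \<noteq> 0" and "invertible M"
  shows "invertible (c *\<^sub>R M)" and "matrix_inv (c *\<^sub>R M) *v (c *\<^sub>R v) = matrix_inv M *v v"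
proof -
  show inv: "invertible (c *\<^sub>R M)"
    using assms by (simp add: scalar_invertible)
  have "(c *\<^sub>R M) *v (matrix_inv M *v v) = c *\<^sub>R (M *v (matrix_inv M *v v))"
    by (rule scaleR_matrix_vector_assoc[symmetric])
  then have "c *\<^sub>R v = (c *\<^sub>R M) *v (matrix_inv M *v v)"
    by (simp only: matrix_vector_mul_assoc matrix_inv_right[OF assms(2)] matrix_vector_mul_lid)
  then show "matrix_inv (c *\<^sub>R M) *v (c *\<^sub>R v) = matrix_inv M *v v"
    by (simp only: matrix_vector_mul_assoc[of "matrix_inv (c *\<^sub>R M)"] matrix_inv_left[OF inv] matrix_vector_mul_lid)
qed

lemma regressor_nth:
  "regressor h z $ 1 = h $ 1 * h $ 1" "regressor h z $ 2 = h $ 2 * h $ 1"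
  "regressor h z $ 3 = h $ 1 * h $ 2" "regressor h z $ 4 = h $ 2 * h $ 2"
  "regressor h z $ 5 = z * h $ 1" "regressor h z $ 6 = z * h $ 2"
  by (simp_all add: regressor_def append_vec_def vector_6 vec_mat_nth outer_def)

lemma P_part_scaled_sum_regressor:
  fixes h :: "'n::finite \<Rightarrow> real^2" and z :: "'n \<Rightarrow> real"
  defines "H \<equiv> (\<chi> i. h i) :: real^2^'n"
  shows "P_part (c *\<^sub>R (\<Sum>i\<in>UNIV. regressor (h i) (z i))) = c *\<^sub>R (transpose H ** H)"
  by (simp add: vec_eq_iff forall_2 P_part_def H_def matrix_matrix_mult_def transpose_def
      sum_component regressor_nth)

lemma q_part_scaled_sum_regressor:
  fixes h :: "'n::finite \<Rightarrow> real^2" and z :: "'n \<Rightarrow> real"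
  defines "H \<equiv> (\<chi> i. h i) :: real^2^'n"
  shows "q_part (c *\<^sub>R (\<Sum>i\<in>UNIV. regressor (h i) (z i))) = c *\<^sub>R (transpose H *v (\<chi> i. z i))"
  by (simp add: vec_eq_iff forall_2 q_part_def H_def matrix_vector_mult_def transpose_def
      sum_component regressor_nth mult.commute)

lemma exhaust_6: "k = 1 \<or> k = 2 \<or> k = 3 \<or> k = 4 \<or> k = 5 \<or> k = 6" for k :: 6
proof (induct k)
  case (of_int z)
  then have "z = 0 \<or> z = 1 \<or> z = 2 \<or> z = 3 \<or> z = 4 \<or> z = 5" by fastforce
  then show ?case by auto
qed

lemma regressor_has_vector_derivative:
  assumes h: "(h has_vector_derivative h') (at t within S)"
    and z: "(z has_vector_derivative z') (at t within S)"
  obtains r' where "((\<lambda>t. regressor (h t) (z t)) has_vector_derivative r') (at t within S)"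
proof -
  have prod: "\<exists>d. ((\<lambda>t. f t * g t) has_vector_derivative d) (at t within S)"
    if "(f has_vector_derivative f') (at t within S)" "(g has_vector_derivative g') (at t within S)"
    for f g :: "real \<Rightarrow> real" and f' g'
    using has_vector_derivative_mult[OF that] by blast
  have hi: "((\<lambda>t. h t $ i) has_vector_derivative h' $ i) (at t within S)" for i
    using h by (simp add: has_vector_derivative_vec_nth_iff)
  have "\<exists>d. ((\<lambda>t. regressor (h t) (z t) $ k) has_vector_derivative d) (at t within S)" for k
    using exhaust_6[of k] by (elim disjE) (simp_all only: regressor_nth prod[OF hi hi] prod[OF z hi])
  then obtain d where "\<And>k. ((\<lambda>t. regressor (h t) (z t) $ k) has_vector_derivative d k) (at t within S)"
    by metis
  then have "((\<lambda>t. regressor (h t) (z t)) has_vector_derivative (\<chi> k. d k)) (at t within S)"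
    by (simp add: has_vector_derivative_vec_nth_iff)
  then show thesis by (rule that)
qed

section \<open>Finite-time convergence of the bearing-only estimates\<close>

theorem theorem2:
  fixes G :: "('n::finite, 'e::finite) pre_digraph"
    and t0 \<gamma> \<beta> n_hat lambda2_hat :: real
    and s :: "'n \<Rightarrow> real^2"
    and p v :: "real \<Rightarrow> real^2"
    and \<theta> :: "'n \<Rightarrow> real \<Rightarrow> real"
    and h :: "'n \<Rightarrow> real \<Rightarrow> real^2"
    and z :: "'n \<Rightarrow> real \<Rightarrow> real"
    and H :: "real \<Rightarrow> real^2^'n"
    and zvec :: "real \<Rightarrow> real^'n"
    and \<phi> :: "'n \<Rightarrow> real \<Rightarrow> real^6"
    and \<phi>vec :: "real \<Rightarrow> real^('n \<times> 6)"
    and \<phi>bar :: "real \<Rightarrow> real^6"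
    and w x xtilde :: "real \<Rightarrow> real^('n \<times> 6)"
    and p_est :: "'n \<Rightarrow> real \<Rightarrow> real^2"
    and p_opt :: "real \<Rightarrow> real^2"
    and t_star :: real
  assumes graph: "graph G" "verts G = UNIV" "arcs G = UNIV"
    and connected: "Digraph_Component.connected G"
    and t0: "t0 \<ge> 0"
    and target: "\<And>t. t \<ge> 0 \<Longrightarrow> (p has_vector_derivative v t) (at t within {0..})"
    and p_neq_s: "\<And>i t. t \<ge> 0 \<Longrightarrow> p t \<noteq> s i"
    and theta_range: "\<And>i t. t \<ge> 0 \<Longrightarrow> \<theta> i t \<in> {0..<2 * pi}"
    and bearing: "\<And>i t. t \<ge> 0 \<Longrightarrow>
           vector [cos (\<theta> i t), sin (\<theta> i t)] = (1 / norm (p t - s i)) *\<^sub>R (p t - s i)"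
    and h_eq: "\<And>i t. t \<ge> 0 \<Longrightarrow> h i t = vector [- sin (\<theta> i t), cos (\<theta> i t)]"
    and z_eq: "\<And>i t. t \<ge> 0 \<Longrightarrow> z i t = h i t \<bullet> s i"
    and H_eq: "\<And>t. t \<ge> 0 \<Longrightarrow> H t = (\<chi> i. h i t)"
    and zvec_eq: "\<And>t. t \<ge> 0 \<Longrightarrow> zvec t = (\<chi> i. z i t)"
    and rank_H: "\<And>t. t \<ge> 0 \<Longrightarrow> rank (H t) = 2"
    and order_gt_2: "2 < CARD('n)"
    and h_C1: "\<And>i. bounded_C1_on {0..} (h i)"
    and z_C1: "\<And>i. bounded_C1_on {0..} (z i)"
    and phi_eq: "\<And>i t. t \<ge> 0 \<Longrightarrow> \<phi> i t = regressor (h i t) (z i t)"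
    and gamma_pos: "\<gamma> > 0"
    and phi_deriv: "\<And>i t. t \<ge> t0 \<Longrightarrow>
           infnorm (vector_derivative (\<phi> i) (at t within {0..})) \<le> \<gamma>"
    and phivec_eq: "\<And>t. t \<ge> 0 \<Longrightarrow> \<phi>vec t = stack (\<lambda>i. \<phi> i t)"
    and phibar_eq: "\<And>t. t \<ge> 0 \<Longrightarrow> \<phi>bar t = (1 / real CARD('n)) *\<^sub>R (\<Sum>i\<in>UNIV. \<phi> i t)"
    and n_hat: "n_hat > 0" "n_hat \<ge> real CARD('n)"
    and lambda2_hat: "lambda2_hat > 0" "lambda2_hat \<le> lambda2 (laplacian G)"
    and beta: "\<beta> \<ge> 1 + \<gamma> * sqrt n_hat / lambda2_hat"
    and w_sol: "filippov_solution (consensus_field G \<beta> \<phi>vec) t0 w"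
    and w_init: "w t0 = 0"
    and x_eq: "\<And>t. t \<ge> t0 \<Longrightarrow> x t = w t + \<phi>vec t"
    and xtilde_eq: "\<And>t. t \<ge> t0 \<Longrightarrow> xtilde t = x t - kron_vec (1 :: real^'n) (\<phi>bar t)"
    and p_est_eq: "\<And>i t. t \<ge> t0 \<Longrightarrow>
           p_est i t = matrix_inv (P_part (block (x t) i)) *v q_part (block (x t) i)"
    and p_opt_eq: "\<And>t. t \<ge> 0 \<Longrightarrow>
           p_opt t = (matrix_inv (transpose (H t) ** H t) ** transpose (H t)) *v zvec t"
    and t_star_eq: "t_star = t0 + norm (xtilde t0) / lambda2 (laplacian G)"
  shows "(\<forall>t\<ge>t0. invertible (transpose (H t) ** H t) \<and>
            {y. is_arg_min (\<lambda>y. 1/2 * (norm (zvec t - H t *v y))\<^sup>2) (\<lambda>_. True) y} = {p_opt t})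
       \<and> (\<forall>t\<ge>t_star. \<forall>i. invertible (P_part (block (x t) i)) \<and> p_est i t = p_opt t)"
proof (intro conjI allI impI)
  interpret simple_connected_graph G
    using graph connected by (intro simple_connected_graph.intro simple_connected_graph_axioms.intro)
  let ?n = "real CARD('n)" and ?\<kappa> = "lambda2 (laplacian G)"
  have \<kappa>_pos: "?\<kappa> > 0" using lambda2_hat by simp
  define \<phi>' where "\<phi>' t = stack (\<lambda>i. vector_derivative (\<phi> i) (at t within {0..}))" for t
  have gram: "invertible (transpose (H t) ** H t)" if "t \<ge> 0" for t
    using rank_H[OF that] by (intro gram_matrix_invertible) simp
  {
    fix t assume "t \<ge> t0"
    then have t: "t \<ge> 0" using t0 by simp
    show "invertible (transpose (H t) ** H t)" using gram[OF t] .
    show "{y. is_arg_min (\<lambda>y. 1/2 * (norm (zvec t - H t *v y))\<^sup>2) (\<lambda>_. True) y} = {p_opt t}"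
      unfolding p_opt_eq[OF t] by (rule least_squares_unique_minimizer[OF gram[OF t]])
  }

  have phi_deriv_works: "(\<phi> i has_vector_derivative vector_derivative (\<phi> i) (at t within {0..}))
      (at t within {0..})" if "t \<ge> 0" for i t
  proof -
    from h_C1[of i] obtain h' where h': "\<forall>t\<in>{0..}. (h i has_vector_derivative h' t) (at t within {0..})"
      unfolding bounded_C1_on_def by blast
    from z_C1[of i] obtain z' where z': "\<forall>t\<in>{0..}. (z i has_vector_derivative z' t) (at t within {0..})"
      unfolding bounded_C1_on_def by blast
    have "t \<in> {0..}" using that by simp
    from regressor_has_vector_derivative[OF h'[rule_format, OF this] z'[rule_format, OF this]]
    obtain r' where r': "((\<lambda>t. regressor (h i t) (z i t)) has_vector_derivative r') (at t within {0..})" .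
    have "(\<phi> i has_vector_derivative r') (at t within {0..})"
      by (rule has_vector_derivative_transform[OF \<open>t \<in> {0..}\<close> _ r']) (simp add: phi_eq)
    then show ?thesis by (rule vector_derivative_works[THEN iffD1, OF differentiableI_vector])
  qed
  have phivec_deriv: "(\<phi>vec has_vector_derivative \<phi>' t) (at t within {t0..})" if "t \<ge> t0" for t
  proof -
    have "((\<lambda>t. \<phi>vec t $ m) has_vector_derivative \<phi>' t $ m) (at t within {0..})" for m
    proof (rule has_vector_derivative_transform)
      show "t \<in> {0..}" using that t0 by simp
      show "\<phi>vec r $ m = \<phi> (fst m) r $ snd m" if "r \<in> {0..}" for r
        using that by (simp add: phivec_eq stack_def)
      show "((\<lambda>t. \<phi> (fst m) t $ snd m) has_vector_derivative \<phi>' t $ m) (at t within {0..})"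
        using phi_deriv_works[of t "fst m"] that t0
        by (simp add: has_vector_derivative_vec_nth_iff \<phi>'_def stack_def)
    qed
    then have "(\<phi>vec has_vector_derivative \<phi>' t) (at t within {0..})"
      by (simp add: has_vector_derivative_vec_nth_iff)
    then show ?thesis
      by (rule has_vector_derivative_within_subset) (use t0 in auto)
  qed
  have phivec_bound: "\<bar>\<phi>' t $ m\<bar> \<le> \<gamma>" if "t \<ge> t0" for t m
    using order_trans[OF component_le_infnorm_cart phi_deriv[OF that]] by (simp add: \<phi>'_def stack_def)
  have gain: "1 + \<gamma> * sqrt ?n / ?\<kappa> \<le> \<beta>"
  proof -
    have "\<gamma> * sqrt ?n / ?\<kappa> \<le> \<gamma> * sqrt n_hat / lambda2_hat"
      using gamma_pos n_hat lambda2_hat by (intro frac_le mult_left_mono) auto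
    then show ?thesis using beta by simp
  qed
  have xtilde: "xtilde t = w t + disagreement (\<phi>vec t)" if "t \<ge> t0" for t
    using that t0
    by (simp add: vec_eq_iff xtilde_eq x_eq phibar_eq phivec_eq kron_vec_def disagreement_def stack_def)

  fix t i assume "t \<ge> t_star"
  have "norm (xtilde t0) / ?\<kappa> \<ge> 0" using \<kappa>_pos by simp
  then have t: "t \<ge> t0" "t \<ge> 0" using \<open>t \<ge> t_star\<close> t_star_eq t0 by linarith+
  have "w t + disagreement (\<phi>vec t) = 0"
  proof (rule consensus_in_finite_time[OF _ \<kappa>_pos phivec_deriv phivec_bound gain w_sol])
    show "t \<ge> t0 + norm (w t0 + disagreement (\<phi>vec t0)) / ?\<kappa>"
      using \<open>t \<ge> t_star\<close> t_star_eq xtilde[of t0] by simp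
  qed (use order_gt_2 w_init in auto)
  then have "x t = kron_vec 1 (\<phi>bar t)" using xtilde[OF t(1)] xtilde_eq[OF t(1)] by simp
  then have block: "block (x t) i = (1 / ?n) *\<^sub>R (\<Sum>i\<in>UNIV. regressor (h i t) (z i t))"
    using phibar_eq[OF t(2)] phi_eq[OF t(2)] by (simp add: vec_eq_iff block_def kron_vec_def)
  have P: "P_part (block (x t) i) = (1 / ?n) *\<^sub>R (transpose (H t) ** H t)"
    unfolding block P_part_scaled_sum_regressor H_eq[OF t(2)] ..
  have q: "q_part (block (x t) i) = (1 / ?n) *\<^sub>R (transpose (H t) *v zvec t)"
    unfolding block q_part_scaled_sum_regressor H_eq[OF t(2)] zvec_eq[OF t(2)] ..
  show "invertible (P_part (block (x t) i))"
    unfolding P by (rule matrix_inv_scaled_mult(1)) (use gram[OF t(2)] in auto)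
  have "p_est i t = matrix_inv (transpose (H t) ** H t) *v (transpose (H t) *v zvec t)"
    unfolding p_est_eq[OF t(1)] P q
    by (rule matrix_inv_scaled_mult(2)) (use gram[OF t(2)] in auto)
  then show "p_est i t = p_opt t"
    unfolding p_opt_eq[OF t(2)] by (simp only: matrix_vector_mul_assoc)
qed


end
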